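(* Let $q_0\in\mathcal{Q}$, $q_0\neq0$, be fixed, and let $H_T(\lambda)=J(\lambda q_0)$ for $\lambda\in\mathbb{R}$, where $J(q)=\frac12\|u_q-z_d\|_{\mathcal{H}}^2+\frac M2\|q\|_{\mathcal{Q}}^2$. For each $T>0$ there exists a unique $\overline{\lambda}(T)\in\mathbb{R}$ such that $$H_T(\overline{\lambda}(T))=\min_{\lambda\in\mathbb{R}}H_T(\lambda).$$
   Context: $\Omega\subset\mathbb{R}^n$ is a bounded domain with regular boundary $\Gamma=\Gamma_1\cup\Gamma_2$, $\Gamma_1,\Gamma_2$ disjoint with positive $(n-1)$-dimensional measure. For $T>0$ put $V=H^1(\Omega)$, $V_0=\{v\in V: v|_{\Gamma_1}=0\}$, $H=L^2(\Omega)$, $Q=L^2(\Gamma_2)$, $\mathcal{H}=L^2(0,T;H)$, $\mathcal{Q}=L^2(0,T;Q)$, and $a(u,v)=\int_\Omega\nabla u\cdot\nabla v\,dx$. Fixed data: $g\in\mathcal{H}$, $z_d\in\mathcal{H}$, $b\in H^{1/2}(\Gamma_1)$, $v_b\in V$ with $v_b=b$ on $\Gamma_1$, and a constant $M>0$; data and domain are sufficiently smooth for the variational problem below to have a unique solution. For $q\in\mathcal{Q}$, $u_q$ is the unique function with $u_q-v_b\in L^2(0,T;V_0)$, $\dot u_q\in L^2(0,T;V_0')$, $u_q(0)=v_b$ and, for a.e. $t\in(0,T)$, $\langle\dot u_q(t),v\rangle+a(u_q(t),v)=(g(t),v)_H-(q(t),v)_Q$ for all $v\in V_0$ (traces are understood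 in $(q(t),v)_Q$). *)

theory Defs
  imports "HOL-Analysis.Analysis"
begin

(* Elements of function spaces are represented by real-valued functions; two functions that
   agree almost everywhere represent the same element. *)

section \<open>Square-integrable functions\<close>

definition L2 :: "'x measure \<Rightarrow> ('x \<Rightarrow> real) set" where
  "L2 M = {f \<in> borel_measurable M. integrable M (\<lambda>x. (f x)\<^sup>2)}"

definition l2_inner :: "'x measure \<Rightarrow> ('x \<Rightarrow> real) \<Rightarrow> ('x \<Rightarrow> real) \<Rightarrow> real" where
  "l2_inner M f g = (LINT x|M. f x * g x)"

definition l2_norm :: "'x measure \<Rightarrow> ('x \<Rightarrow> real) \<Rightarrow> real" where
  "l2_norm M f = sqrt (l2_inner M f f)"


section \<open>Surface measure\<close>

(* The factor unit_ball_vol d / 2 ^ d normalises the d-dimensional Hausdorff measure so that it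
   is the surface measure on d-dimensional surfaces.  Empty covering sets contribute 0 also for
   d = 0; boundedness is required because diameter is unspecified on unbounded sets. *)
definition hausdorff_pre :: "nat \<Rightarrow> real \<Rightarrow> 'a::metric_space set \<Rightarrow> ennreal" where
  "hausdorff_pre d \<delta> A =
     (INF C \<in> {C :: nat \<Rightarrow> 'a set. A \<subseteq> (\<Union>i. C i) \<and> (\<forall>i. bounded (C i) \<and> diameter (C i) \<le> \<delta>)}.
        \<Sum>i. if C i = {} then 0 else ennreal (unit_ball_vol (real d) * (diameter (C i) / 2) ^ d))"

definition hausdorff_outer :: "nat \<Rightarrow> 'a::metric_space set \<Rightarrow> ennreal" where
  "hausdorff_outer d A = (SUP \<delta>\<in>{0<..}. hausdorff_pre d \<delta> A)"

(* hausdorff_outer d is a metric outer measure, hence countably additive on the Borel sets. *)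
definition hausdorff_measure :: "nat \<Rightarrow> 'a::metric_space measure" where
  "hausdorff_measure d = measure_of UNIV (sets borel) (hausdorff_outer d)"

definition surface_measure :: "'a::euclidean_space measure" where
  "surface_measure = completion (hausdorff_measure (DIM('a) - 1))"

abbreviation surface_on :: "'a::euclidean_space set \<Rightarrow> 'a measure" where
  "surface_on \<Gamma> \<equiv> restrict_space surface_measure \<Gamma>"


section \<open>Domains\<close>

(* Near every boundary point the domain is, with respect to a suitable direction \<nu>, the
   region strictly below the graph of a Lipschitz function of the component orthogonal to \<nu>. *)
definition lipschitz_boundary :: "'a::euclidean_space set \<Rightarrow> bool" where
  "lipschitz_boundary \<Omega> \<longleftrightarrow>
     (\<forall>x\<in>frontier \<Omega>. \<exists>r>0. \<exists>\<nu> (\<gamma> :: 'a \<Rightarrow> real) L. norm \<nu> = 1 \<and> L-lipschitz_on UNIV \<gamma> \<and>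
        \<Omega> \<inter> ball x r = {y \<in> ball x r. y \<bullet> \<nu> < \<gamma> (y - (y \<bullet> \<nu>) *\<^sub>R \<nu>)})"

definition regular_bounded_domain :: "'a::euclidean_space set \<Rightarrow> bool" where
  "regular_bounded_domain \<Omega> \<longleftrightarrow>
     open \<Omega> \<and> connected \<Omega> \<and> \<Omega> \<noteq> {} \<and> bounded \<Omega> \<and> lipschitz_boundary \<Omega>"


section \<open>Sobolev spaces\<close>

definition partial_deriv :: "'a::euclidean_space \<Rightarrow> ('a \<Rightarrow> real) \<Rightarrow> 'a \<Rightarrow> real" where
  "partial_deriv b f x = frechet_derivative f (at x) b"

primrec C_upto :: "nat \<Rightarrow> ('a::euclidean_space \<Rightarrow> real) \<Rightarrow> bool" where
  "C_upto 0 f \<longleftrightarrow> continuous_on UNIV f"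
| "C_upto (Suc k) f \<longleftrightarrow>
     (\<forall>x. f differentiable (at x)) \<and> (\<forall>b\<in>Basis. C_upto k (partial_deriv b f))"

definition C_infinity :: "('a::euclidean_space \<Rightarrow> real) set" where
  "C_infinity = {f. \<forall>k. C_upto k f}"

definition test_functions :: "'a::euclidean_space set \<Rightarrow> ('a \<Rightarrow> real) set" where
  "test_functions \<Omega> =
     {\<phi> \<in> C_infinity. compact (closure {x. \<phi> x \<noteq> 0}) \<and> closure {x. \<phi> x \<noteq> 0} \<subseteq> \<Omega>}"

definition has_weak_gradient ::
  "'a::euclidean_space set \<Rightarrow> ('a \<Rightarrow> real) \<Rightarrow> ('a \<Rightarrow> 'a) \<Rightarrow> bool" where
  "has_weak_gradient \<Omega> f G \<longleftrightarrow>
     (\<forall>b\<in>Basis. (\<lambda>x. G x \<bullet> b) \<in> L2 (lebesgue_on \<Omega>) \<and>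
        (\<forall>\<phi>\<in>test_functions \<Omega>.
           l2_inner (lebesgue_on \<Omega>) f (partial_deriv b \<phi>)
           = - l2_inner (lebesgue_on \<Omega>) (\<lambda>x. G x \<bullet> b) \<phi>))"

definition weak_gradient :: "'a::euclidean_space set \<Rightarrow> ('a \<Rightarrow> real) \<Rightarrow> 'a \<Rightarrow> 'a" where
  "weak_gradient \<Omega> f = (SOME G. has_weak_gradient \<Omega> f G)"

definition H1 :: "'a::euclidean_space set \<Rightarrow> ('a \<Rightarrow> real) set" where
  "H1 \<Omega> = {f \<in> L2 (lebesgue_on \<Omega>). \<exists>G. has_weak_gradient \<Omega> f G}"

definition dirichlet_form ::
  "'a::euclidean_space set \<Rightarrow> ('a \<Rightarrow> real) \<Rightarrow> ('a \<Rightarrow> real) \<Rightarrow> real" where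
  "dirichlet_form \<Omega> u v = (LINT x|lebesgue_on \<Omega>. weak_gradient \<Omega> u x \<bullet> weak_gradient \<Omega> v x)"

definition h1_norm :: "'a::euclidean_space set \<Rightarrow> ('a \<Rightarrow> real) \<Rightarrow> real" where
  "h1_norm \<Omega> v = sqrt ((l2_norm (lebesgue_on \<Omega>) v)\<^sup>2 + dirichlet_form \<Omega> v v)"

(* The trace operator is the continuous extension to H1 of the restriction of smooth functions
   to the boundary.  It is used in relational form: by the trace theorem every element of H1 on
   a bounded Lipschitz domain has exactly one trace up to surface null sets.  The memberships
   of the approximants hold automatically there; they are stated because the Bochner integral
   of a non-integrable function is 0. *)
definition has_trace :: "'a::euclidean_space set \<Rightarrow> ('a \<Rightarrow> real) \<Rightarrow> ('a \<Rightarrow> real) \<Rightarrow> bool" where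
  "has_trace \<Omega> v w \<longleftrightarrow>
     v \<in> H1 \<Omega> \<and> w \<in> L2 (surface_on (frontier \<Omega>)) \<and>
     (\<exists>\<phi> :: nat \<Rightarrow> 'a \<Rightarrow> real.
        (\<forall>k. \<phi> k \<in> C_infinity \<inter> H1 \<Omega> \<inter> L2 (surface_on (frontier \<Omega>))) \<and>
        (\<lambda>k. h1_norm \<Omega> (\<lambda>x. \<phi> k x - v x)) \<longlonglongrightarrow> 0 \<and>
        (\<lambda>k. l2_norm (surface_on (frontier \<Omega>)) (\<lambda>x. \<phi> k x - w x)) \<longlonglongrightarrow> 0)"

definition has_trace_on ::
  "'a::euclidean_space set \<Rightarrow> 'a set \<Rightarrow> ('a \<Rightarrow> real) \<Rightarrow> ('a \<Rightarrow> real) \<Rightarrow> bool" where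
  "has_trace_on \<Omega> \<Gamma> v b \<longleftrightarrow> (\<exists>w. has_trace \<Omega> v w \<and> (AE x in surface_on \<Gamma>. w x = b x))"

definition H1_zero_on :: "'a::euclidean_space set \<Rightarrow> 'a set \<Rightarrow> ('a \<Rightarrow> real) set" where
  "H1_zero_on \<Omega> \<Gamma> = {v \<in> H1 \<Omega>. has_trace_on \<Omega> \<Gamma> v (\<lambda>_. 0)}"

(* Sobolev-Slobodeckij space of order 1/2 on the (n-1)-dimensional set \<Gamma>: the exponent of
   the kernel is (n - 1) + 2 * (1/2) = n. *)
definition H_half :: "'a::euclidean_space set \<Rightarrow> ('a \<Rightarrow> real) set" where
  "H_half \<Gamma> = {b \<in> L2 (surface_on \<Gamma>).
     (\<integral>\<^sup>+x. \<integral>\<^sup>+y. ennreal ((b x - b y)\<^sup>2 / dist x y ^ DIM('a)) \<partial>surface_on \<Gamma> \<partial>surface_on \<Gamma>) < \<infinity>}"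


section \<open>Bochner spaces\<close>

abbreviation time_interval :: "real \<Rightarrow> real measure" where
  "time_interval T \<equiv> lebesgue_on {0<..<T}"

(* X is a vector space of real-valued functions and N a seminorm on it.  Besides function spaces
   on a domain this covers dual spaces, whose elements are real-valued functions on functions. *)
definition strongly_measurable ::
  "real \<Rightarrow> ('x \<Rightarrow> real) set \<Rightarrow> (('x \<Rightarrow> real) \<Rightarrow> real) \<Rightarrow> (real \<Rightarrow> 'x \<Rightarrow> real) \<Rightarrow> bool" where
  "strongly_measurable T X N u \<longleftrightarrow>
     (AE t in time_interval T. u t \<in> X) \<and>
     (\<exists>s :: nat \<Rightarrow> real \<Rightarrow> 'x \<Rightarrow> real.
        (\<forall>k. simple_function (time_interval T) (s k) \<and> s k ` {0<..<T} \<subseteq> X) \<and>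
        (AE t in time_interval T. (\<lambda>k. N (\<lambda>x. s k t x - u t x)) \<longlonglongrightarrow> 0))"

definition bochner_L2 ::
  "real \<Rightarrow> ('x \<Rightarrow> real) set \<Rightarrow> (('x \<Rightarrow> real) \<Rightarrow> real) \<Rightarrow> (real \<Rightarrow> 'x \<Rightarrow> real) set" where
  "bochner_L2 T X N =
     {u. strongly_measurable T X N u \<and> integrable (time_interval T) (\<lambda>t. (N (u t))\<^sup>2)}"

definition bochner_norm ::
  "real \<Rightarrow> (('x \<Rightarrow> real) \<Rightarrow> real) \<Rightarrow> (real \<Rightarrow> 'x \<Rightarrow> real) \<Rightarrow> real" where
  "bochner_norm T N u = sqrt (LINT t|time_interval T. (N (u t))\<^sup>2)"

abbreviation L2_L2 :: "real \<Rightarrow> 'x measure \<Rightarrow> (real \<Rightarrow> 'x \<Rightarrow> real) set" where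
  "L2_L2 T M \<equiv> bochner_L2 T (L2 M) (l2_norm M)"

abbreviation L2_L2_norm :: "real \<Rightarrow> 'x measure \<Rightarrow> (real \<Rightarrow> 'x \<Rightarrow> real) \<Rightarrow> real" where
  "L2_L2_norm T M \<equiv> bochner_norm T (l2_norm M)"

(* Equality almost everywhere in t of elements of L2 M. *)
definition bochner_eq ::
  "real \<Rightarrow> 'x measure \<Rightarrow> (real \<Rightarrow> 'x \<Rightarrow> real) \<Rightarrow> (real \<Rightarrow> 'x \<Rightarrow> real) \<Rightarrow> bool" where
  "bochner_eq T M u v \<longleftrightarrow> (AE t in time_interval T. AE x in M. u t x = v t x)"

(* Only the values of a functional on X matter. *)
definition dual_space ::
  "('x \<Rightarrow> real) set \<Rightarrow> (('x \<Rightarrow> real) \<Rightarrow> real) \<Rightarrow> (('x \<Rightarrow> real) \<Rightarrow> real) set" where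
  "dual_space X N =
     {F. (\<forall>u\<in>X. \<forall>v\<in>X. \<forall>\<alpha> \<beta>. F (\<lambda>x. \<alpha> * u x + \<beta> * v x) = \<alpha> * F u + \<beta> * F v) \<and>
         (\<exists>C. \<forall>v\<in>X. \<bar>F v\<bar> \<le> C * N v)}"

definition dual_norm ::
  "('x \<Rightarrow> real) set \<Rightarrow> (('x \<Rightarrow> real) \<Rightarrow> real) \<Rightarrow> (('x \<Rightarrow> real) \<Rightarrow> real) \<Rightarrow> real" where
  "dual_norm X N F = (SUP v\<in>{v\<in>X. N v \<le> 1}. \<bar>F v\<bar>)"

(* The derivative is taken in the sense of distributions on the open interval (0,T) with values
   in the dual of X, where L2 M is embedded into that dual through the inner product of L2 M. *)
definition has_weak_time_derivative ::
  "real \<Rightarrow> 'x measure \<Rightarrow> ('x \<Rightarrow> real) set \<Rightarrow> (real \<Rightarrow> 'x \<Rightarrow> real)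
     \<Rightarrow> (real \<Rightarrow> ('x \<Rightarrow> real) \<Rightarrow> real) \<Rightarrow> bool" where
  "has_weak_time_derivative T M X u F \<longleftrightarrow>
     (\<forall>\<psi>\<in>test_functions {0<..<T}. \<forall>v\<in>X.
        (LINT t|time_interval T. l2_inner M (u t) v * deriv \<psi> t)
        = - (LINT t|time_interval T. F t v * \<psi> t))"

definition continuous_into_L2 :: "real \<Rightarrow> 'x measure \<Rightarrow> (real \<Rightarrow> 'x \<Rightarrow> real) \<Rightarrow> bool" where
  "continuous_into_L2 T M u \<longleftrightarrow>
     (\<forall>s\<in>{0..T}. u s \<in> L2 M \<and>
        ((\<lambda>t. l2_norm M (\<lambda>x. u t x - u s x)) \<longlongrightarrow> 0) (at s within {0..T}))"

(* The value at time 0 is that of the representative which is continuous from [0,T] into L2 M. *)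
definition has_initial_value ::
  "real \<Rightarrow> 'x measure \<Rightarrow> (real \<Rightarrow> 'x \<Rightarrow> real) \<Rightarrow> ('x \<Rightarrow> real) \<Rightarrow> bool" where
  "has_initial_value T M u u0 \<longleftrightarrow>
     (\<exists>c. continuous_into_L2 T M c \<and> bochner_eq T M u c \<and> (AE x in M. c 0 x = u0 x))"


section \<open>The parabolic problem and the cost functional\<close>

definition solves_heat ::
  "'a::euclidean_space set \<Rightarrow> 'a set \<Rightarrow> 'a set \<Rightarrow> real \<Rightarrow> (real \<Rightarrow> 'a \<Rightarrow> real) \<Rightarrow> ('a \<Rightarrow> real)
     \<Rightarrow> (real \<Rightarrow> 'a \<Rightarrow> real) \<Rightarrow> (real \<Rightarrow> 'a \<Rightarrow> real) \<Rightarrow> bool" where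
  "solves_heat \<Omega> \<Gamma>1 \<Gamma>2 T g v\<^sub>b q u \<longleftrightarrow>
     (let V\<^sub>0 = H1_zero_on \<Omega> \<Gamma>1; H = lebesgue_on \<Omega> in
      (\<lambda>t x. u t x - v\<^sub>b x) \<in> bochner_L2 T V\<^sub>0 (h1_norm \<Omega>) \<and>
      has_initial_value T H u v\<^sub>b \<and>
      (\<exists>u'. u' \<in> bochner_L2 T (dual_space V\<^sub>0 (h1_norm \<Omega>)) (dual_norm V\<^sub>0 (h1_norm \<Omega>)) \<and>
         has_weak_time_derivative T H V\<^sub>0 u u' \<and>
         (AE t in time_interval T. \<forall>v\<in>V\<^sub>0. \<forall>w. has_trace \<Omega> v w \<longrightarrow>
            u' t v + dirichlet_form \<Omega> (u t) v
            = l2_inner H (g t) v - l2_inner (surface_on \<Gamma>2) (q t) w)))"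

(* Determined up to bochner_eq whenever heat_well_posed holds. *)
definition heat_state ::
  "'a::euclidean_space set \<Rightarrow> 'a set \<Rightarrow> 'a set \<Rightarrow> real \<Rightarrow> (real \<Rightarrow> 'a \<Rightarrow> real) \<Rightarrow> ('a \<Rightarrow> real)
     \<Rightarrow> (real \<Rightarrow> 'a \<Rightarrow> real) \<Rightarrow> real \<Rightarrow> 'a \<Rightarrow> real" where
  "heat_state \<Omega> \<Gamma>1 \<Gamma>2 T g v\<^sub>b q = (SOME u. solves_heat \<Omega> \<Gamma>1 \<Gamma>2 T g v\<^sub>b q u)"

definition heat_well_posed ::
  "'a::euclidean_space set \<Rightarrow> 'a set \<Rightarrow> 'a set \<Rightarrow> real \<Rightarrow> (real \<Rightarrow> 'a \<Rightarrow> real) \<Rightarrow> ('a \<Rightarrow> real)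
     \<Rightarrow> bool" where
  "heat_well_posed \<Omega> \<Gamma>1 \<Gamma>2 T g v\<^sub>b \<longleftrightarrow>
     (\<forall>q \<in> L2_L2 T (surface_on \<Gamma>2). \<exists>u. solves_heat \<Omega> \<Gamma>1 \<Gamma>2 T g v\<^sub>b q u \<and>
        (\<forall>u'. solves_heat \<Omega> \<Gamma>1 \<Gamma>2 T g v\<^sub>b q u' \<longrightarrow> bochner_eq T (lebesgue_on \<Omega>) u' u))"

definition cost ::
  "'a::euclidean_space set \<Rightarrow> 'a set \<Rightarrow> 'a set \<Rightarrow> real \<Rightarrow> (real \<Rightarrow> 'a \<Rightarrow> real) \<Rightarrow> ('a \<Rightarrow> real)
     \<Rightarrow> (real \<Rightarrow> 'a \<Rightarrow> real) \<Rightarrow> real \<Rightarrow> (real \<Rightarrow> 'a \<Rightarrow> real) \<Rightarrow> real" where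
  "cost \<Omega> \<Gamma>1 \<Gamma>2 T g v\<^sub>b z\<^sub>d M q =
     1/2 * (L2_L2_norm T (lebesgue_on \<Omega>) (\<lambda>t x. heat_state \<Omega> \<Gamma>1 \<Gamma>2 T g v\<^sub>b q t x - z\<^sub>d t x))\<^sup>2
     + M/2 * (L2_L2_norm T (surface_on \<Gamma>2) q)\<^sup>2"

end

theory Submission
  imports Defs
begin

text \<open>The problem for \<open>u\<^sub>q\<close> is affine in the pair of state and control, so by uniqueness
  the state at \<open>\<lambda> q\<^sub>0\<close> is \<open>1 - \<lambda>\<close> times the state at \<open>0\<close> plus \<open>\<lambda>\<close> times the state at
  \<open>q\<^sub>0\<close>. Hence the cost is a quadratic polynomial in \<open>\<lambda>\<close> whose leading coefficient is at
  least \<open>M/2\<close> times the squared norm of \<open>q\<^sub>0\<close>, and this is positive. Linearity of the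
  Dirichlet form rests on the almost everywhere uniqueness of weak gradients, that is, on the
  fundamental lemma of the calculus of variations.\<close>

text \<open>Function spaces consist of functions, not of classes, and \<open>weak_gradient\<close>
  and \<open>heat_state\<close> are mere choices. Linearity therefore holds only almost everywhere,
  and each clause of \<open>solves_heat\<close> has to be shown stable under combinations in that
  sense. A second obstacle is that the integral of a non-integrable function is 0, so every
  splitting of an integral needs integrability, in space and in time. The time variable is handled
  by one principle: a functional that is Lipschitz for the seminorm turns a strongly measurable map
  into a measurable real function of time. Norms, pairings with a fixed L2 function and evaluation
  of dual elements are all of this kind. The only time dependence it does not cover is the inner
  product of two moving functions, which is recovered by polarisation. The data \<open>g\<close> and
  \<open>v\<^sub>b\<close> are inhomogeneous, so only coefficients with sum 1 preserve the
  problem.\<close>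

section \<open>Seminormed spaces of functions\<close>

text \<open>Definiteness is left out because functions that agree almost everywhere have distance 0.
  A single inequality for two-term combinations packs subadditivity and homogeneity together, and
  nothing is asked of \<open>N\<close> outside \<open>X\<close>. The same locale then serves L2, H1,
  its subspace with zero trace, and dual spaces.\<close>

locale seminormed_functions =
  fixes X :: "('x \<Rightarrow> real) set" and N :: "('x \<Rightarrow> real) \<Rightarrow> real"
  assumes comb_mem: "u \<in> X \<Longrightarrow> v \<in> X \<Longrightarrow> (\<lambda>x. \<alpha> * u x + \<beta> * v x) \<in> X"
    and comb_le: "u \<in> X \<Longrightarrow> v \<in> X \<Longrightarrow> N (\<lambda>x. \<alpha> * u x + \<beta> * v x) \<le> \<bar>\<alpha>\<bar> * N u + \<bar>\<beta>\<bar> * N v"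
    and nonneg: "u \<in> X \<Longrightarrow> 0 \<le> N u"
begin

lemma scale_mem: "u \<in> X \<Longrightarrow> (\<lambda>x. \<alpha> * u x) \<in> X"
  using comb_mem[of u u \<alpha> 0] by simp

lemma scale_le: "u \<in> X \<Longrightarrow> N (\<lambda>x. \<alpha> * u x) \<le> \<bar>\<alpha>\<bar> * N u"
  using comb_le[of u u \<alpha> 0] by simp

lemma diff_mem: "u \<in> X \<Longrightarrow> v \<in> X \<Longrightarrow> (\<lambda>x. u x - v x) \<in> X"
  using comb_mem[of u v 1 "-1"] by simp

lemma diff_commute_le: "u \<in> X \<Longrightarrow> v \<in> X \<Longrightarrow> N (\<lambda>x. u x - v x) \<le> N (\<lambda>x. v x - u x)"
  using scale_le[OF diff_mem, of v u "-1"] by simp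

lemma abs_diff_le:
  assumes "u \<in> X" "v \<in> X"
  shows "\<bar>N u - N v\<bar> \<le> N (\<lambda>x. u x - v x)"
proof -
  have "N u \<le> N (\<lambda>x. u x - v x) + N v" if "u \<in> X" "v \<in> X" for u v
    using comb_le[OF diff_mem[OF that] that(2), of 1 1] by simp
  from this[OF assms] this[OF assms(2,1)] diff_commute_le[OF assms(2,1)]
  show ?thesis by linarith
qed

lemma subspace:
  assumes "Y \<subseteq> X" "\<And>u v \<alpha> \<beta>. u \<in> Y \<Longrightarrow> v \<in> Y \<Longrightarrow> (\<lambda>x. \<alpha> * u x + \<beta> * v x) \<in> Y"
  shows "seminormed_functions Y N"
proof
  fix u v \<alpha> \<beta> assume "u \<in> Y" "v \<in> Y"
  then show "(\<lambda>x. \<alpha> * u x + \<beta> * v x) \<in> Y"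
      "N (\<lambda>x. \<alpha> * u x + \<beta> * v x) \<le> \<bar>\<alpha>\<bar> * N u + \<bar>\<beta>\<bar> * N v"
    using assms(1) by (auto intro: assms(2) comb_le)
next
  show "0 \<le> N u" if "u \<in> Y" for u using that assms(1) by (auto intro: nonneg)
qed

end

text \<open>The quadratic form of a combination is nonnegative for all coefficients, which gives
  Cauchy-Schwarz and with it the triangle inequality. As \<open>B\<close> is only semidefinite,
  \<open>B u u = 0\<close> must be treated apart.\<close>

lemma seminormed_functionsI_inner:
  fixes B :: "('x \<Rightarrow> real) \<Rightarrow> ('x \<Rightarrow> real) \<Rightarrow> real"
  assumes mem: "\<And>u v \<alpha> \<beta>. u \<in> X \<Longrightarrow> v \<in> X \<Longrightarrow> (\<lambda>x. \<alpha> * u x + \<beta> * v x) \<in> X"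
    and lin: "\<And>u v w \<alpha> \<beta>. u \<in> X \<Longrightarrow> v \<in> X \<Longrightarrow> w \<in> X \<Longrightarrow>
      B (\<lambda>x. \<alpha> * u x + \<beta> * v x) w = \<alpha> * B u w + \<beta> * B v w"
    and sym: "\<And>u v. B u v = B v u"
    and pos: "\<And>u. 0 \<le> B u u"
  shows "seminormed_functions X (\<lambda>u. sqrt (B u u))"
    and "\<And>u v. u \<in> X \<Longrightarrow> v \<in> X \<Longrightarrow> \<bar>B u v\<bar> \<le> sqrt (B u u) * sqrt (B v v)"
proof -
  have expand: "B (\<lambda>x. \<alpha> * u x + \<beta> * v x) (\<lambda>x. \<alpha> * u x + \<beta> * v x)
      = \<alpha>\<^sup>2 * B u u + 2 * (\<alpha> * \<beta> * B u v) + \<beta>\<^sup>2 * B v v"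
    if "u \<in> X" "v \<in> X" for u v \<alpha> \<beta>
  proof -
    let ?w = "\<lambda>x. \<alpha> * u x + \<beta> * v x"
    have "B ?w ?w = \<alpha> * B ?w u + \<beta> * B ?w v"
      using lin[OF that mem[OF that]] sym by metis
    then show ?thesis
      using lin[OF that that(1)] lin[OF that that(2)] sym[of v u]
      by (simp add: algebra_simps power2_eq_square)
  qed
  show CS: "\<bar>B u v\<bar> \<le> sqrt (B u u) * sqrt (B v v)" if "u \<in> X" "v \<in> X" for u v
  proof -
    have q: "0 \<le> \<alpha>\<^sup>2 * B u u + 2 * (\<alpha> * \<beta> * B u v) + \<beta>\<^sup>2 * B v v" for \<alpha> \<beta>
      using pos expand[OF that] by metis
    have "(B u v)\<^sup>2 \<le> B u u * B v v"
    proof (cases "B u u = 0")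
      case True
      have "B u v = 0"
      proof (rule ccontr)
        assume "B u v \<noteq> 0"
        \<comment> \<open>With \<open>B u u = 0\<close> the form is affine in
          \<open>\<alpha>\<close> when \<open>\<beta> = 1\<close>; this value of
          \<open>\<alpha>\<close> makes it equal to -1.\<close>
        with True q[of "- (B v v + 1) / (2 * B u v)" 1] show False by (simp add: field_simps)
      qed
      with True show ?thesis by simp
    next
      case False
      then have "B u u > 0" using pos[of u] by linarith
      moreover have "0 \<le> B u u * (B u u * B v v - (B u v)\<^sup>2)"
        \<comment> \<open>These are the coefficients of the orthogonal projection multiplied through
          by \<open>B u u\<close>, so that no division occurs.\<close>
        using q[of "- B u v" "B u u"] by (simp add: algebra_simps power2_eq_square)
      ultimately show ?thesis by (simp add: zero_le_mult_iff)
    qed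
    then have "sqrt ((B u v)\<^sup>2) \<le> sqrt (B u u * B v v)" by (rule real_sqrt_le_mono)
    then show ?thesis by (simp add: real_sqrt_mult)
  qed
  show "seminormed_functions X (\<lambda>u. sqrt (B u u))"
  proof
    fix u v \<alpha> \<beta> assume uv: "u \<in> X" "v \<in> X"
    let ?w = "\<lambda>x. \<alpha> * u x + \<beta> * v x"
    have "\<alpha> * \<beta> * B u v \<le> \<bar>\<alpha>\<bar> * \<bar>\<beta>\<bar> * (sqrt (B u u) * sqrt (B v v))"
      using mult_left_mono[OF CS[OF uv], of "\<bar>\<alpha> * \<beta>\<bar>"] abs_ge_self[of "\<alpha> * \<beta> * B u v"]
      by (simp add: abs_mult)
    then have "B ?w ?w \<le> (\<bar>\<alpha>\<bar> * sqrt (B u u) + \<bar>\<beta>\<bar> * sqrt (B v v))\<^sup>2"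
      unfolding expand[OF uv] using pos[of u] pos[of v]
      by (simp add: power2_sum power_mult_distrib algebra_simps)
    then show "sqrt (B ?w ?w) \<le> \<bar>\<alpha>\<bar> * sqrt (B u u) + \<bar>\<beta>\<bar> * sqrt (B v v)"
      using pos by (intro real_le_lsqrt) simp_all
  qed (use mem pos in auto)
qed

section \<open>The space L2 and its inner product\<close>

lemma L2_mult_integrable:
  assumes "f \<in> L2 M" "g \<in> L2 M"
  shows "integrable M (\<lambda>x. f x * g x)"
proof (rule Bochner_Integration.integrable_bound[where f = "\<lambda>x. (f x)\<^sup>2 + (g x)\<^sup>2"])
  show "integrable M (\<lambda>x. (f x)\<^sup>2 + (g x)\<^sup>2)" "(\<lambda>x. f x * g x) \<in> borel_measurable M"
    using assms by (auto simp: L2_def)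
  show "AE x in M. norm (f x * g x) \<le> norm ((f x)\<^sup>2 + (g x)\<^sup>2)"
  proof (rule AE_I2)
    fix x
    have "2 * \<bar>f x * g x\<bar> \<le> (f x)\<^sup>2 + (g x)\<^sup>2"
      using sum_squares_bound[of "\<bar>f x\<bar>" "\<bar>g x\<bar>"] by (simp add: abs_mult)
    then show "norm (f x * g x) \<le> norm ((f x)\<^sup>2 + (g x)\<^sup>2)" by simp
  qed
qed

lemma L2_comb:
  assumes "f \<in> L2 M" "g \<in> L2 M"
  shows "(\<lambda>x. \<alpha> * f x + \<beta> * g x) \<in> L2 M"
proof -
  have "integrable M (\<lambda>x. \<alpha>\<^sup>2 * (f x)\<^sup>2 + 2 * \<alpha> * \<beta> * (f x * g x) + \<beta>\<^sup>2 * (g x)\<^sup>2)"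
    using assms L2_mult_integrable[OF assms] by (auto simp: L2_def)
  then have "integrable M (\<lambda>x. (\<alpha> * f x + \<beta> * g x)\<^sup>2)"
    by (simp add: power2_sum power_mult_distrib algebra_simps)
  then show ?thesis using assms by (auto simp: L2_def)
qed

lemma (in finite_measure) L2_bounded:
  assumes "f \<in> borel_measurable M" "\<And>x. x \<in> space M \<Longrightarrow> \<bar>f x\<bar> \<le> C"
  shows "f \<in> L2 M"
proof -
  have "integrable M (\<lambda>x. (f x)\<^sup>2)"
  proof (rule integrable_const_bound[where B = "C\<^sup>2"])
    show "AE x in M. norm ((f x)\<^sup>2) \<le> C\<^sup>2"
      using assms(2) by (intro AE_I2) (force simp: abs_le_square_iff[symmetric])
  qed (use assms in simp)
  then show ?thesis using assms by (simp add: L2_def)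
qed

lemma l2_inner_comb_left:
  assumes "f \<in> L2 M" "g \<in> L2 M" "h \<in> L2 M"
  shows "l2_inner M (\<lambda>x. \<alpha> * f x + \<beta> * g x) h = \<alpha> * l2_inner M f h + \<beta> * l2_inner M g h"
proof -
  have "l2_inner M (\<lambda>x. \<alpha> * f x + \<beta> * g x) h = (LINT x|M. \<alpha> * (f x * h x) + \<beta> * (g x * h x))"
    unfolding l2_inner_def by (simp add: algebra_simps)
  then show ?thesis
    unfolding l2_inner_def
    using L2_mult_integrable[OF assms(1,3)] L2_mult_integrable[OF assms(2,3)] by simp
qed

lemma l2_inner_commute: "l2_inner M f g = l2_inner M g f"
  by (simp add: l2_inner_def mult.commute)

lemma l2_inner_self_nonneg: "0 \<le> l2_inner M f f"
  by (simp add: l2_inner_def)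

lemma l2_norm_power2: "(l2_norm M f)\<^sup>2 = l2_inner M f f"
  by (simp add: l2_norm_def l2_inner_self_nonneg)

lemma l2_norm_scale: "l2_norm M (\<lambda>x. c * f x) = \<bar>c\<bar> * l2_norm M f"
proof -
  have "l2_inner M (\<lambda>x. c * f x) (\<lambda>x. c * f x) = (LINT x|M. c\<^sup>2 * (f x * f x))"
    unfolding l2_inner_def by (simp add: power2_eq_square algebra_simps)
  then show ?thesis by (simp add: l2_norm_def l2_inner_def real_sqrt_mult)
qed

interpretation L2: seminormed_functions "L2 M" "l2_norm M" for M :: "'x measure"
  unfolding l2_norm_def
  by (rule seminormed_functionsI_inner(1))
    (auto intro: L2_comb l2_inner_comb_left l2_inner_commute l2_inner_self_nonneg)

lemma l2_inner_le:
  assumes "f \<in> L2 M" "g \<in> L2 M"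
  shows "\<bar>l2_inner M f g\<bar> \<le> l2_norm M f * l2_norm M g"
  unfolding l2_norm_def
  by (rule seminormed_functionsI_inner(2)[OF _ _ _ _ assms])
    (auto intro: L2_comb l2_inner_comb_left l2_inner_commute l2_inner_self_nonneg)

section \<open>Dual spaces\<close>

context seminormed_functions
begin

text \<open>\<open>dual_norm\<close> is a supremum of reals and can be used only once the set is
  known to be bounded. The constant \<open>C\<close> may be negative, hence its absolute value in
  the bound.\<close>

lemma dual_bdd_above:
  assumes F: "F \<in> dual_space X N"
  shows "bdd_above ((\<lambda>v. \<bar>F v\<bar>) ` {v \<in> X. N v \<le> 1})"
proof -
  obtain C where C: "\<And>v. v \<in> X \<Longrightarrow> \<bar>F v\<bar> \<le> C * N v"
    using F unfolding dual_space_def by blast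
  show ?thesis
  proof (rule bdd_aboveI2)
    fix w assume w: "w \<in> {v \<in> X. N v \<le> 1}"
    then have "\<bar>F w\<bar> \<le> C * N w" using C by simp
    also have "\<dots> \<le> \<bar>C\<bar> * N w" using w nonneg by (simp add: mult_right_mono)
    also have "\<dots> \<le> \<bar>C\<bar> * 1" using w by (intro mult_left_mono) auto
    finally show "\<bar>F w\<bar> \<le> \<bar>C\<bar>" by simp
  qed
qed

lemma dual_le:
  assumes F: "F \<in> dual_space X N" and v: "v \<in> X"
  shows "\<bar>F v\<bar> \<le> dual_norm X N F * N v"
proof -
  obtain C where C: "\<And>v. v \<in> X \<Longrightarrow> \<bar>F v\<bar> \<le> C * N v"
    using F unfolding dual_space_def by blast
  have hom: "F (\<lambda>x. c * v x) = c * F v" for c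
  proof -
    have "\<forall>u\<in>X. \<forall>v\<in>X. \<forall>\<alpha> \<beta>. F (\<lambda>x. \<alpha> * u x + \<beta> * v x) = \<alpha> * F u + \<beta> * F v"
      using F by (simp add: dual_space_def)
    from this[rule_format, OF v v, of c 0] show ?thesis by simp
  qed
  show ?thesis
  \<comment> \<open>A vector of seminorm 0 cannot be normalised; there the bound
    \<open>C * N v\<close> already forces \<open>F v = 0\<close>.\<close>
  proof (cases "N v = 0")
    case True
    with C[OF v] show ?thesis by simp
  next
    case False
    then have pos: "N v > 0" using nonneg[OF v] by simp
    let ?w = "\<lambda>x. (1 / N v) * v x"
    have "N ?w \<le> 1" using scale_le[OF v, of "1 / N v"] pos by simp
    then have "\<bar>F ?w\<bar> \<le> dual_norm X N F"
      unfolding dual_norm_def using scale_mem[OF v, of "1 / N v"]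
      by (intro cSUP_upper[OF _ dual_bdd_above[OF F]]) simp
    then show ?thesis using pos unfolding hom by (simp add: abs_mult field_simps)
  qed
qed

text \<open>Nonemptiness puts the zero function into the unit ball, so that the supremum in
  \<open>dual_norm\<close> is never taken over the empty set.\<close>

lemma dual_seminormed:
  assumes ne: "X \<noteq> {}"
  shows "seminormed_functions (dual_space X N) (dual_norm X N)"
proof
  have "(\<lambda>x. 0) \<in> X" using ne scale_mem[of _ 0] by auto
  moreover have "N (\<lambda>x. 0) \<le> 0" using ne scale_le[of _ 0] by auto
  ultimately have zero: "(\<lambda>x. 0) \<in> {v \<in> X. N v \<le> 1}" by simp
  show dn: "0 \<le> dual_norm X N F" if "F \<in> dual_space X N" for F
    using cSUP_upper[OF zero dual_bdd_above[OF that]] unfolding dual_norm_def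
    by (meson abs_ge_zero order_trans)
  fix F G \<alpha> \<beta> assume F: "F \<in> dual_space X N" and G: "G \<in> dual_space X N"
  have le: "\<bar>\<alpha> * F v + \<beta> * G v\<bar> \<le> (\<bar>\<alpha>\<bar> * dual_norm X N F + \<bar>\<beta>\<bar> * dual_norm X N G) * N v"
    if "v \<in> X" for v
  proof -
    have "\<bar>\<alpha> * F v + \<beta> * G v\<bar> \<le> \<bar>\<alpha>\<bar> * \<bar>F v\<bar> + \<bar>\<beta>\<bar> * \<bar>G v\<bar>"
      by (metis abs_mult abs_triangle_ineq)
    also have "\<dots> \<le> \<bar>\<alpha>\<bar> * (dual_norm X N F * N v) + \<bar>\<beta>\<bar> * (dual_norm X N G * N v)"
      using dual_le[OF F that] dual_le[OF G that] by (intro add_mono mult_left_mono) auto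
    finally show ?thesis by (simp add: algebra_simps)
  qed
  have "\<exists>C. \<forall>v\<in>X. \<bar>\<alpha> * F v + \<beta> * G v\<bar> \<le> C * N v" using le by blast
  then show "(\<lambda>v. \<alpha> * F v + \<beta> * G v) \<in> dual_space X N"
    using F G unfolding dual_space_def by (simp add: algebra_simps)
  show "dual_norm X N (\<lambda>v. \<alpha> * F v + \<beta> * G v) \<le> \<bar>\<alpha>\<bar> * dual_norm X N F + \<bar>\<beta>\<bar> * dual_norm X N G"
    unfolding dual_norm_def[of X N "\<lambda>v. \<alpha> * F v + \<beta> * G v"]
  proof (rule cSUP_least)
    fix v assume v: "v \<in> {v \<in> X. N v \<le> 1}"
    have "\<bar>\<alpha> * F v + \<beta> * G v\<bar> \<le> (\<bar>\<alpha>\<bar> * dual_norm X N F + \<bar>\<beta>\<bar> * dual_norm X N G) * N v"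
      using le v by simp
    also have "\<dots> \<le> (\<bar>\<alpha>\<bar> * dual_norm X N F + \<bar>\<beta>\<bar> * dual_norm X N G) * 1"
      using v dn[OF F] dn[OF G] by (intro mult_left_mono) auto
    finally show "\<bar>\<alpha> * F v + \<beta> * G v\<bar> \<le> \<bar>\<alpha>\<bar> * dual_norm X N F + \<bar>\<beta>\<bar> * dual_norm X N G"
      by simp
  qed (use zero in blast)
qed

end

section \<open>Bochner spaces\<close>

text \<open>Lebesgue measure is complete, so changing a function on a null set keeps it measurable.
  Extension by 0 moves the claim from \<open>S\<close> to the whole space.\<close>

lemma borel_measurable_lebesgue_on_AE:
  fixes f g :: "'a::euclidean_space \<Rightarrow> real"
  assumes S: "S \<in> sets lebesgue" and f: "f \<in> borel_measurable (lebesgue_on S)"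
    and ae: "AE x in lebesgue_on S. f x = g x"
  shows "g \<in> borel_measurable (lebesgue_on S)"
proof -
  have "(\<lambda>x. if x \<in> S then f x else 0) \<in> borel_measurable lebesgue"
    using borel_measurable_if_lebesgue_on[OF S, of UNIV f] f by simp
  moreover have "AE x in lebesgue. (if x \<in> S then f x else 0) = (if x \<in> S then g x else 0)"
    using ae S by (simp add: AE_restrict_space_iff if_distrib cong: if_cong)
  ultimately have "(\<lambda>x. if x \<in> S then g x else 0) \<in> borel_measurable lebesgue"
    by (rule borel_measurable_AE)
  then show ?thesis
    using borel_measurable_if_lebesgue_on[OF S, of UNIV g] by simp
qed

lemma borel_measurable_lebesgue_on_AE_LIMSEQ:
  fixes f :: "nat \<Rightarrow> 'a::euclidean_space \<Rightarrow> real"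
  assumes S: "S \<in> sets lebesgue" and f: "\<And>k. f k \<in> borel_measurable (lebesgue_on S)"
    and lim: "AE x in lebesgue_on S. (\<lambda>k. f k x) \<longlonglongrightarrow> g x"
  shows "g \<in> borel_measurable (lebesgue_on S)"
proof (rule borel_measurable_lebesgue_on_AE[OF S])
  show "(\<lambda>x. lim (\<lambda>k. f k x)) \<in> borel_measurable (lebesgue_on S)"
    using f by measurable
  show "AE x in lebesgue_on S. lim (\<lambda>k. f k x) = g x"
    using lim by eventually_elim (rule limI)
qed

lemma L2_time_bound:
  assumes g: "g \<in> L2 (time_interval T)" and f: "f \<in> borel_measurable (time_interval T)"
    and le: "AE t in time_interval T. \<bar>f t\<bar> \<le> g t"
  shows "f \<in> L2 (time_interval T)"
proof -
  have "integrable (time_interval T) (\<lambda>t. (f t)\<^sup>2)"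
  proof (rule Bochner_Integration.integrable_bound)
    show "integrable (time_interval T) (\<lambda>t. (g t)\<^sup>2)" using g by (simp add: L2_def)
    show "AE t in time_interval T. norm ((f t)\<^sup>2) \<le> norm ((g t)\<^sup>2)"
      using le by eventually_elim (simp add: abs_le_square_iff[symmetric])
  qed (use f in simp)
  with f show ?thesis by (simp add: L2_def)
qed

lemma time_interval_finite: "finite_measure (time_interval T)"
  by (rule finite_measure_lebesgue_on) simp

context seminormed_functions
begin

text \<open>Composing \<open>L\<close> with the approximating simple functions gives simple
  functions again, without any sigma-algebra on \<open>X\<close>. By the Lipschitz bound they
  converge almost everywhere to \<open>L (u t)\<close>, even if \<open>L\<close> is not linear;
  \<open>L = N\<close> is one of the uses.\<close>

lemma strongly_measurable_functional:
  assumes u: "strongly_measurable T X N u"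
    and L: "\<And>f g. f \<in> X \<Longrightarrow> g \<in> X \<Longrightarrow> \<bar>L f - L g\<bar> \<le> K * N (\<lambda>x. f x - g x)"
  shows "(\<lambda>t. L (u t) :: real) \<in> borel_measurable (time_interval T)"
proof -
  obtain s where s: "\<And>k. simple_function (time_interval T) (s k)" "\<And>k. s k ` {0<..<T} \<subseteq> X"
      and lim: "AE t in time_interval T. (\<lambda>k. N (\<lambda>x. s k t x - u t x)) \<longlonglongrightarrow> 0"
    using u by (auto simp: strongly_measurable_def)
  show ?thesis
  proof (rule borel_measurable_lebesgue_on_AE_LIMSEQ)
    show "(\<lambda>t. L (s k t)) \<in> borel_measurable (time_interval T)" for k
      by (rule borel_measurable_simple_function[OF simple_function_compose1[OF s(1)]])
    have "AE t in time_interval T. u t \<in> X" using u by (simp add: strongly_measurable_def)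
    moreover have "AE t in time_interval T. t \<in> {0<..<T}" by (rule AE_I2) simp
    ultimately show "AE t in time_interval T. (\<lambda>k. L (s k t)) \<longlonglongrightarrow> L (u t)"
      using lim
    proof eventually_elim
      case (elim t)
      have "(\<lambda>k. L (s k t) - L (u t)) \<longlonglongrightarrow> 0"
      proof (rule Lim_null_comparison)
        show "\<forall>\<^sub>F k in sequentially. norm (L (s k t) - L (u t)) \<le> K * N (\<lambda>x. s k t x - u t x)"
          using elim s(2) by (intro always_eventually allI) (simp add: L image_subset_iff)
        show "(\<lambda>k. K * N (\<lambda>x. s k t x - u t x)) \<longlonglongrightarrow> 0"
          using tendsto_mult_right_zero[OF elim(3)] by simp
      qed
      then show ?case by (simp add: LIM_zero_iff)
    qed
  qed simp
qed

lemma bochner_L2_norm_L2: "u \<in> bochner_L2 T X N \<Longrightarrow> (\<lambda>t. N (u t)) \<in> L2 (time_interval T)"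
  unfolding bochner_L2_def L2_def
  using strongly_measurable_functional[of T u N 1] abs_diff_le by auto

text \<open>\<open>bochner_L2\<close> only mentions the square of the norm; membership in L2 also
  asks that \<open>N (u t)\<close> itself be measurable, which comes from strong
  measurability.\<close>

lemma bochner_L2_iff:
  "u \<in> bochner_L2 T X N \<longleftrightarrow> strongly_measurable T X N u \<and> (\<lambda>t. N (u t)) \<in> L2 (time_interval T)"
  using bochner_L2_norm_L2 by (auto simp: bochner_L2_def L2_def)

lemma bochner_L2_mem: "u \<in> bochner_L2 T X N \<Longrightarrow> AE t in time_interval T. u t \<in> X"
  by (simp add: bochner_L2_def strongly_measurable_def)

text \<open>Compatibility with differences turns the bound on \<open>L\<close> into a Lipschitz
  bound.\<close>

lemma bochner_L2_functional:
  assumes u: "u \<in> bochner_L2 T X N"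
    and diff: "\<And>f g. f \<in> X \<Longrightarrow> g \<in> X \<Longrightarrow> L (\<lambda>x. f x - g x) = L f - L g"
    and le: "\<And>f. f \<in> X \<Longrightarrow> \<bar>L f\<bar> \<le> K * N f"
  shows "(\<lambda>t. L (u t)) \<in> L2 (time_interval T)"
proof (rule L2_time_bound)
  show "(\<lambda>t. K * N (u t)) \<in> L2 (time_interval T)"
    by (rule L2.scale_mem[OF bochner_L2_norm_L2[OF u]])
  show "(\<lambda>t. L (u t)) \<in> borel_measurable (time_interval T)"
    using u le[OF diff_mem] by (intro strongly_measurable_functional[of T u L K])
      (auto simp: bochner_L2_def diff)
  show "AE t in time_interval T. \<bar>L (u t)\<bar> \<le> K * N (u t)"
    using bochner_L2_mem[OF u] by eventually_elim (rule le)
qed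

lemma bochner_L2_comb:
  assumes u: "u \<in> bochner_L2 T X N" and v: "v \<in> bochner_L2 T X N"
  shows "(\<lambda>t x. \<alpha> * u t x + \<beta> * v t x) \<in> bochner_L2 T X N"
proof -
  let ?w = "\<lambda>t x. \<alpha> * u t x + \<beta> * v t x"
  obtain r where r: "\<And>k. simple_function (time_interval T) (r k)" "\<And>k. r k ` {0<..<T} \<subseteq> X"
      and rlim: "AE t in time_interval T. (\<lambda>k. N (\<lambda>x. r k t x - u t x)) \<longlonglongrightarrow> 0"
    using u by (auto simp: bochner_L2_def strongly_measurable_def)
  obtain s where s: "\<And>k. simple_function (time_interval T) (s k)" "\<And>k. s k ` {0<..<T} \<subseteq> X"
      and slim: "AE t in time_interval T. (\<lambda>k. N (\<lambda>x. s k t x - v t x)) \<longlonglongrightarrow> 0"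
    using v by (auto simp: bochner_L2_def strongly_measurable_def)
  have mem: "AE t in time_interval T. t \<in> {0<..<T} \<and> u t \<in> X \<and> v t \<in> X"
    using bochner_L2_mem[OF u] bochner_L2_mem[OF v] AE_space[of "time_interval T"]
    by eventually_elim simp
  have sm: "strongly_measurable T X N ?w"
    unfolding strongly_measurable_def
  proof (intro conjI exI allI)
    let ?q = "\<lambda>k t x. \<alpha> * r k t x + \<beta> * s k t x"
    show "AE t in time_interval T. ?w t \<in> X"
      using mem by eventually_elim (auto intro: comb_mem)
    show "simple_function (time_interval T) (?q k)" for k
      by (rule simple_function_compose2[OF r(1) s(1), where h = "\<lambda>f g x. \<alpha> * f x + \<beta> * g x"])
    show "?q k ` {0<..<T} \<subseteq> X" for k
      using r(2)[of k] s(2)[of k] by (auto intro!: comb_mem)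
    show "AE t in time_interval T. (\<lambda>k. N (\<lambda>x. ?q k t x - ?w t x)) \<longlonglongrightarrow> 0"
      using mem rlim slim
    proof eventually_elim
      case (elim t)
      have rs: "r k t \<in> X" "s k t \<in> X" for k
        using elim r(2)[of k] s(2)[of k] by auto
      have eq: "(\<lambda>x. ?q k t x - ?w t x)
          = (\<lambda>x. \<alpha> * (r k t x - u t x) + \<beta> * (s k t x - v t x))" for k
        by (simp add: algebra_simps)
      have dm: "(\<lambda>x. r k t x - u t x) \<in> X" "(\<lambda>x. s k t x - v t x) \<in> X" for k
        using elim rs by (auto intro: diff_mem)
      show ?case
      proof (rule Lim_null_comparison)
        show "\<forall>\<^sub>F k in sequentially. norm (N (\<lambda>x. ?q k t x - ?w t x))
            \<le> \<bar>\<alpha>\<bar> * N (\<lambda>x. r k t x - u t x) + \<bar>\<beta>\<bar> * N (\<lambda>x. s k t x - v t x)"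
          unfolding eq using comb_le[OF dm] nonneg[OF comb_mem[OF dm]]
          by (intro always_eventually) simp
        show "(\<lambda>k. \<bar>\<alpha>\<bar> * N (\<lambda>x. r k t x - u t x) + \<bar>\<beta>\<bar> * N (\<lambda>x. s k t x - v t x)) \<longlonglongrightarrow> 0"
          by (rule tendsto_eq_intros tendsto_const elim refl)+ simp
      qed
    qed
  qed
  moreover have "(\<lambda>t. N (?w t)) \<in> L2 (time_interval T)"
  proof (rule L2_time_bound)
    show "(\<lambda>t. \<bar>\<alpha>\<bar> * N (u t) + \<bar>\<beta>\<bar> * N (v t)) \<in> L2 (time_interval T)"
      by (intro L2_comb bochner_L2_norm_L2 u v)
    show "(\<lambda>t. N (?w t)) \<in> borel_measurable (time_interval T)"
      using sm by (rule strongly_measurable_functional[where K = 1]) (simp add: abs_diff_le)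
    show "AE t in time_interval T. \<bar>N (?w t)\<bar> \<le> \<bar>\<alpha>\<bar> * N (u t) + \<bar>\<beta>\<bar> * N (v t)"
      using mem by eventually_elim (simp add: comb_le comb_mem nonneg)
  qed
  ultimately show ?thesis by (simp add: bochner_L2_iff)
qed

lemma bochner_L2_const:
  assumes "f \<in> X"
  shows "(\<lambda>_. f) \<in> bochner_L2 T X N"
proof -
  interpret finite_measure "time_interval T" by (rule time_interval_finite)
  have "N (\<lambda>x. f x - f x) = 0"
    using scale_le[OF assms, of 0] nonneg[OF scale_mem[OF assms, of 0]] by simp
  then have "strongly_measurable T X N (\<lambda>_. f)"
    unfolding strongly_measurable_def using assms
    by (intro conjI exI[of _ "\<lambda>_ _. f"]) auto
  then show ?thesis by (simp add: bochner_L2_def)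
qed

text \<open>The same approximants work in the larger space, since they converge faster than the
  weaker seminorm requires. This carries states from \<open>H1_zero_on\<close> to \<open>H1\<close>
  and from there to L2.\<close>

lemma bochner_L2_mono:
  assumes Y: "seminormed_functions Y N'" and sub: "X \<subseteq> Y" and le: "\<And>f. f \<in> X \<Longrightarrow> N' f \<le> N f"
    and u: "u \<in> bochner_L2 T X N"
  shows "u \<in> bochner_L2 T Y N'"
proof -
  interpret Y: seminormed_functions Y N' by (rule Y)
  obtain s where s: "\<And>k. simple_function (time_interval T) (s k)" "\<And>k. s k ` {0<..<T} \<subseteq> X"
      and lim: "AE t in time_interval T. (\<lambda>k. N (\<lambda>x. s k t x - u t x)) \<longlonglongrightarrow> 0"
    using u by (auto simp: bochner_L2_def strongly_measurable_def)
  have mem: "AE t in time_interval T. t \<in> {0<..<T} \<and> u t \<in> X"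
    using bochner_L2_mem[OF u] AE_space[of "time_interval T"]
    by eventually_elim simp
  have sm: "strongly_measurable T Y N' u"
    unfolding strongly_measurable_def
  proof (intro conjI exI allI)
    show "AE t in time_interval T. u t \<in> Y" using mem by eventually_elim (use sub in auto)
    show "simple_function (time_interval T) (s k)" "s k ` {0<..<T} \<subseteq> Y" for k
      using s[of k] sub by auto
    show "AE t in time_interval T. (\<lambda>k. N' (\<lambda>x. s k t x - u t x)) \<longlonglongrightarrow> 0"
      using mem lim
    proof eventually_elim
      case (elim t)
      have "(\<lambda>x. s k t x - u t x) \<in> X" for k
        using elim s(2)[of k] by (auto simp: image_subset_iff intro: diff_mem)
      then have "norm (N' (\<lambda>x. s k t x - u t x)) \<le> N (\<lambda>x. s k t x - u t x)" for k
        using le Y.nonneg sub by (simp add: subset_iff)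
      then show ?case
        by (intro Lim_null_comparison[OF always_eventually elim(2)]) simp
    qed
  qed
  moreover have "(\<lambda>t. N' (u t)) \<in> L2 (time_interval T)"
  proof (rule L2_time_bound)
    show "(\<lambda>t. N (u t)) \<in> L2 (time_interval T)" by (rule bochner_L2_norm_L2[OF u])
    show "(\<lambda>t. N' (u t)) \<in> borel_measurable (time_interval T)"
      using sm by (rule Y.strongly_measurable_functional[where K = 1]) (simp add: Y.abs_diff_le)
    show "AE t in time_interval T. \<bar>N' (u t)\<bar> \<le> N (u t)"
      using mem by eventually_elim (use le Y.nonneg sub in \<open>auto simp: subset_iff\<close>)
  qed
  ultimately show ?thesis by (simp add: Y.bochner_L2_iff)
qed

end

section \<open>Smooth functions\<close>

lemma partial_deriv_eq: "(f has_derivative f') (at x) \<Longrightarrow> partial_deriv b f x = f' b"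
  unfolding partial_deriv_def by (metis frechet_derivative_at)

lemma C_upto_continuous: "C_upto k f \<Longrightarrow> continuous_on UNIV f"
  by (cases k) (auto simp: continuous_on_eq_continuous_within intro: differentiable_imp_continuous_within)

text \<open>The recursion of \<open>C_upto\<close> records continuity only at its last level, so
  descending one level rests on differentiable functions being continuous.\<close>

lemma C_upto_pred: "C_upto (Suc k) f \<Longrightarrow> C_upto k f"
  by (induction k arbitrary: f) (auto simp: continuous_on_eq_continuous_within intro: differentiable_imp_continuous_within)

lemma partial_deriv_comb:
  assumes "f differentiable (at x)" "g differentiable (at x)"
  shows "partial_deriv b (\<lambda>x. \<alpha> * f x + \<beta> * g x) x = \<alpha> * partial_deriv b f x + \<beta> * partial_deriv b g x"
proof -
  obtain f' g' where d: "(f has_derivative f') (at x)" "(g has_derivative g') (at x)"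
    using assms unfolding differentiable_def by blast
  have "((\<lambda>x. \<alpha> * f x + \<beta> * g x) has_derivative (\<lambda>h. \<alpha> * f' h + \<beta> * g' h)) (at x)"
    by (intro derivative_intros d)
  then show ?thesis using d by (simp add: partial_deriv_eq)
qed

lemma C_upto_comb: "C_upto k f \<Longrightarrow> C_upto k g \<Longrightarrow> C_upto k (\<lambda>x. \<alpha> * f x + \<beta> * g x)"
proof (induction k arbitrary: f g \<alpha> \<beta>)
  case (Suc k)
  then have "partial_deriv b (\<lambda>x. \<alpha> * f x + \<beta> * g x)
      = (\<lambda>x. \<alpha> * partial_deriv b f x + \<beta> * partial_deriv b g x)" for b
    by (intro ext partial_deriv_comb) simp_all
  then show ?case using Suc by auto
qed (simp add: continuous_on_add continuous_on_mult)

lemma C_upto_const: "C_upto k (\<lambda>_. c)"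
proof (induction k arbitrary: c)
  case (Suc k)
  have "partial_deriv b (\<lambda>_. c) = (\<lambda>_. 0)" for b :: 'a
    by (rule ext) (simp add: partial_deriv_eq[OF has_derivative_const])
  then show ?case using Suc[of 0] by simp
qed auto

lemma C_upto_mult: "C_upto k f \<Longrightarrow> C_upto k g \<Longrightarrow> C_upto k (\<lambda>x. f x * g x)"
proof (induction k arbitrary: f g)
  case (Suc k)
  \<comment> \<open>The factors 1 give the product rule the shape of a two-term combination, as
    \<open>C_upto_comb\<close> expects.\<close>
  have "partial_deriv b (\<lambda>x. f x * g x) x = 1 * (partial_deriv b f x * g x) + 1 * (f x * partial_deriv b g x)"
    for b x
  proof -
    obtain f' g' where d: "(f has_derivative f') (at x)" "(g has_derivative g') (at x)"
      using Suc.prems unfolding C_upto.simps differentiable_def by meson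
    from partial_deriv_eq[OF has_derivative_mult[OF d]] show ?thesis
      using d by (simp add: partial_deriv_eq)
  qed
  then have eq: "partial_deriv b (\<lambda>x. f x * g x)
      = (\<lambda>x. 1 * (partial_deriv b f x * g x) + 1 * (f x * partial_deriv b g x))" for b by blast
  have "C_upto k (partial_deriv b (\<lambda>x. f x * g x))" if "b \<in> Basis" for b
    unfolding eq using that Suc.prems C_upto_pred[of k f] C_upto_pred[of k g]
    by (intro C_upto_comb Suc.IH) auto
  then show ?case using Suc.prems by (auto intro: differentiable_mult)
qed (simp add: continuous_on_add continuous_on_mult)

lemma C_upto_prod: "finite I \<Longrightarrow> (\<And>i. i \<in> I \<Longrightarrow> C_upto k (f i)) \<Longrightarrow> C_upto k (\<lambda>x. \<Prod>i\<in>I. f i x)"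
  by (induction I rule: finite_induct) (simp_all add: C_upto_const C_upto_mult)

lemma C_infinity_comb: "f \<in> C_infinity \<Longrightarrow> g \<in> C_infinity \<Longrightarrow> (\<lambda>x. \<alpha> * f x + \<beta> * g x) \<in> C_infinity"
  by (auto simp: C_infinity_def intro: C_upto_comb)

lemma C_infinity_continuous: "f \<in> C_infinity \<Longrightarrow> continuous_on UNIV f"
  using C_upto_continuous[of 0 f] by (simp add: C_infinity_def)

lemma C_infinity_partial_deriv_continuous:
  assumes "f \<in> C_infinity" "b \<in> Basis"
  shows "continuous_on UNIV (partial_deriv b f)"
proof -
  have "C_upto 1 f" using assms by (simp add: C_infinity_def)
  then show ?thesis using assms by simp
qed

text \<open>The class \<open>x \<mapsto> x\<^sup>-\<^sup>m exp (-1/x)\<close> of functions vanishing for \<open>x \<le> 0\<close> is closed under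
  differentiation, which is what makes \<open>exp (-1/x)\<close> smooth.\<close>

definition flat :: "nat \<Rightarrow> real \<Rightarrow> real" where
  "flat m x = (if x \<le> 0 then 0 else inverse x ^ m * exp (- inverse x))"

text \<open>With y = 1/x the limit from the right is that of y^m / exp y at infinity.\<close>

lemma flat_tendsto_0: "(flat m \<longlongrightarrow> 0) (at 0)"
proof (rule filterlim_split_at)
  have "((\<lambda>x. inverse x ^ m / exp (inverse x)) \<longlongrightarrow> (0::real)) (at_right 0)"
    using filterlim_compose[OF tendsto_power_div_exp_0 filterlim_inverse_at_top_right] .
  then show "(flat m \<longlongrightarrow> 0) (at_right 0)"
    by (rule Lim_transform_eventually)
      (auto simp: eventually_at_filter flat_def exp_minus divide_inverse)
  show "(flat m \<longlongrightarrow> 0) (at_left 0)"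
    by (rule Lim_transform_eventually[OF tendsto_const])
      (auto simp: eventually_at_filter flat_def)
qed

lemma flat_has_derivative:
  "(flat m has_real_derivative flat (m + 2) x - real m * flat (m + 1) x) (at x)"
proof -
  consider "x < 0" | "x = 0" | "x > 0" by linarith
  then show ?thesis
  proof cases
    case 1
    have "((\<lambda>_. 0) has_real_derivative 0) (at x)" by simp
    then have "(flat m has_real_derivative 0) (at x)"
      by (rule has_field_derivative_transform_within_open[where S = "{..<0}"])
        (use 1 in \<open>auto simp: flat_def\<close>)
    with 1 show ?thesis by (simp add: flat_def)
  next
    case 2
    \<comment> \<open>Dividing \<open>flat m h\<close> by \<open>h\<close> gives
      \<open>flat (m + 1) h\<close>, so the difference quotient at 0 is a function whose limit is
      known.\<close>
    have "((\<lambda>h. (flat m h - flat m 0) / (h - 0)) \<longlongrightarrow> 0) (at 0)"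
      by (rule Lim_transform_eventually[OF flat_tendsto_0[of "m + 1"]])
        (auto simp: eventually_at_filter flat_def divide_inverse)
    then have "(flat m has_real_derivative 0) (at 0)" by (simp add: has_field_derivative_iff)
    with 2 show ?thesis by (simp add: flat_def)
  next
    case 3
    have "((\<lambda>x. inverse x ^ m * exp (- inverse x)) has_real_derivative
        flat (m + 2) x - real m * flat (m + 1) x) (at x)"
      using 3 by (auto intro!: derivative_eq_intros simp: flat_def power2_eq_square)
        (cases m; simp add: field_simps power_add)
    then show ?thesis
      by (rule has_field_derivative_transform_within_open[where S = "{0<..}"])
        (use 3 in \<open>auto simp: flat_def\<close>)
  qed
qed

text \<open>Each partial derivative is a combination of the functions with \<open>m + 2\<close> and
  \<open>m + 1\<close> and the same affine argument, so the induction on \<open>k\<close> closes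
  when \<open>m\<close> is left free.\<close>

lemma C_upto_flat_affine: "C_upto k (\<lambda>x. flat m (x \<bullet> c + d))"
proof (induction k arbitrary: m)
  case 0
  have "continuous_on UNIV (flat m)"
    by (meson DERIV_isCont continuous_at_imp_continuous_on flat_has_derivative)
  moreover have "continuous_on UNIV (\<lambda>x. x \<bullet> c + d)" by (intro continuous_intros)
  ultimately show ?case by (auto intro: continuous_on_compose2)
next
  case (Suc k)
  have d: "((\<lambda>x. flat m (x \<bullet> c + d)) has_derivative
      (\<lambda>h. (h \<bullet> c) * (flat (m + 2) (x \<bullet> c + d) - real m * flat (m + 1) (x \<bullet> c + d)))) (at x)" for x
    by (rule derivative_eq_intros DERIV_compose_FDERIV[OF flat_has_derivative] refl | simp)+
  have eq: "partial_deriv b (\<lambda>x. flat m (x \<bullet> c + d)) = (\<lambda>x. (b \<bullet> c) * flat (m + 2) (x \<bullet> c + d)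
      + (- (b \<bullet> c) * real m) * flat (m + 1) (x \<bullet> c + d))" for b
    by (rule ext, subst partial_deriv_eq[OF d]) (simp add: algebra_simps)
  have "(\<lambda>x. flat m (x \<bullet> c + d)) differentiable (at x)" for x
    using d by (rule differentiableI)
  moreover have "C_upto k (partial_deriv b (\<lambda>x. flat m (x \<bullet> c + d)))" for b
    unfolding eq by (rule C_upto_comb[OF Suc.IH Suc.IH])
  ultimately show ?case by simp
qed

section \<open>The fundamental lemma of the calculus of variations\<close>

text \<open>Each factor is exp(-1/s), with s the distance to a face scaled by \<open>n\<close>, cut
  off at s <= 0. For positive \<open>n\<close> the product is positive exactly on the open box, and
  it tends to 1 there as \<open>n\<close> grows. It thus approximates the indicator of the box by
  smooth functions bounded by 1.\<close>

definition box_bump :: "'a::euclidean_space \<Rightarrow> 'a \<Rightarrow> real \<Rightarrow> 'a \<Rightarrow> real" where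
  "box_bump a b n x = (\<Prod>i\<in>Basis. flat 0 (n * (x \<bullet> i - a \<bullet> i)) * flat 0 (n * (b \<bullet> i - x \<bullet> i)))"

lemma flat_0_bounds: "0 \<le> flat 0 x" "flat 0 x \<le> 1"
  by (simp_all add: flat_def)

lemma box_bump_bounds: "0 \<le> box_bump a b n x" "box_bump a b n x \<le> 1"
  unfolding box_bump_def
  by (auto intro!: prod_nonneg prod_le_1 mult_nonneg_nonneg mult_le_one simp: flat_0_bounds)

lemma box_bump_eq_0: "n > 0 \<Longrightarrow> x \<notin> box a b \<Longrightarrow> box_bump a b n x = 0"
  by (force simp: box_bump_def flat_def mem_box not_less mult_le_0_iff)

lemma box_bump_C_infinity: "box_bump a b n \<in> C_infinity"
proof -
  \<comment> \<open>The arguments are brought into the form \<open>x \<bullet> c + d\<close>, with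
    \<open>c\<close> a multiple of the basis vector.\<close>
  have "C_upto k (\<lambda>x. flat 0 (x \<bullet> (n *\<^sub>R i) + - n * (a \<bullet> i)) * flat 0 (x \<bullet> (- n *\<^sub>R i) + n * (b \<bullet> i)))" for k i
    by (intro C_upto_mult C_upto_flat_affine)
  then have "C_upto k (\<lambda>x. flat 0 (n * (x \<bullet> i - a \<bullet> i)) * flat 0 (n * (b \<bullet> i - x \<bullet> i)))" for k i
    by (simp add: algebra_simps)
  then show ?thesis
    unfolding C_infinity_def box_bump_def[abs_def] by (auto intro: C_upto_prod)
qed

lemma box_bump_test_function:
  assumes "n > 0" "cbox a b \<subseteq> \<Omega>"
  shows "box_bump a b n \<in> test_functions \<Omega>"
proof -
  have "{x. box_bump a b n x \<noteq> 0} \<subseteq> cbox a b"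
    using box_bump_eq_0[OF assms(1)] box_subset_cbox by blast
  then have "closure {x. box_bump a b n x \<noteq> 0} \<subseteq> cbox a b"
    by (rule closure_minimal) (rule closed_cbox)
  moreover from this have "compact (closure {x. box_bump a b n x \<noteq> 0})"
    by (metis bounded_cbox bounded_subset closed_closure compact_eq_bounded_closed)
  ultimately show ?thesis
    using assms(2) box_bump_C_infinity by (auto simp: test_functions_def)
qed

lemma box_bump_tendsto: "(\<lambda>n. box_bump a b (real (Suc n)) x) \<longlonglongrightarrow> indicator (box a b) x"
proof (cases "x \<in> box a b")
  case True
  have lim: "(\<lambda>n. flat 0 (real (Suc n) * c)) \<longlonglongrightarrow> 1" if "c > 0" for c
  proof -
    have "(\<lambda>n. exp (- (inverse (real (Suc n)) * inverse c))) \<longlonglongrightarrow> exp (- (0 * inverse c))"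
      by (intro tendsto_intros LIMSEQ_inverse_real_of_nat)
    moreover have "flat 0 (real (Suc n) * c) = exp (- (inverse (real (Suc n)) * inverse c))" for n
      using that by (simp add: flat_def not_le)
    ultimately show ?thesis by simp
  qed
  have "(\<lambda>n. box_bump a b (real (Suc n)) x) \<longlonglongrightarrow> (\<Prod>i\<in>(Basis::'a set). 1 * 1)"
    unfolding box_bump_def using True by (intro tendsto_prod tendsto_mult lim) (auto simp: mem_box)
  with True show ?thesis by simp
next
  case False
  then show ?thesis using box_bump_eq_0[of _ x a b] by simp
qed

lemma borel_measurable_lebesgue_on_continuous:
  fixes f :: "'a::euclidean_space \<Rightarrow> real"
  assumes "continuous_on UNIV f"
  shows "f \<in> borel_measurable (lebesgue_on S)"
  using borel_measurable_continuous_onI[OF assms]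
  by (simp add: measurable_completion measurable_restrict_space1)

text \<open>Dynkin's argument: boxes are stable under intersection and generate the Borel sets, and
  the sets over which a fixed integrable function has integral 0 are closed under complement and
  disjoint union. Cutting \<open>g\<close> off outside \<open>box a b\<close> reduces arbitrary
  boxes to those the hypothesis speaks of.\<close>

lemma AE_zero_if_box_integrals_zero:
  fixes g :: "'a::euclidean_space \<Rightarrow> real"
  assumes g: "integrable lborel g"
    and zero: "\<And>p q. box p q \<noteq> {} \<Longrightarrow> cbox p q \<subseteq> cbox a b \<Longrightarrow> (LINT x|lborel. indicator (box p q) x * g x) = 0"
  shows "AE x in lborel. x \<in> box a b \<longrightarrow> g x = 0"
proof -
  let ?G = "\<lambda>x. indicator (box a b) x * g x"
  have G: "integrable lborel ?G"
    using integrable_mult_indicator[OF _ g, of "box a b"] by simp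
  have GA: "integrable lborel (\<lambda>x. indicator A x * ?G x)" if "A \<in> sets borel" for A
    using integrable_mult_indicator[OF _ G, of A] that by simp
  have box: "(LINT x|lborel. indicator (box p q) x * ?G x) = 0" for p q
  proof -
    obtain r s where rs: "box p q \<inter> box a b = box r s" by (rule that) (rule box_Int_box)
    \<comment> \<open>An empty open box may have a nonempty closed box, so closures are compared
      only when \<open>box r s\<close> is nonempty.\<close>
    have "(LINT x|lborel. indicator (box r s) x * g x) = 0"
    proof (cases "box r s = {}")
      case False
      have "box r s \<subseteq> cbox a b" using rs box_subset_cbox by blast
      then have "cbox r s \<subseteq> cbox a b"
        using closure_minimal[OF _ closed_cbox] closure_box[OF False] by metis
      with False show ?thesis by (rule zero)
    qed simp
    then show ?thesis
      by (simp add: rs[symmetric] indicator_inter_arith mult.assoc)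
  qed
  have "Int_stable (range (\<lambda>(a, b). box a b :: 'a set))"
    by (auto simp: Int_stable_def box_Int_box)
  then have all: "(LINT x|lborel. indicator A x * ?G x) = 0" if "A \<in> sets borel" for A
  proof (rule sigma_sets_induct_disjoint[where \<Omega> = UNIV and A = A
        and P = "\<lambda>A. (LINT x|lborel. indicator A x * ?G x) = 0"])
    show "A \<in> sigma_sets UNIV (range (\<lambda>(a, b). box a b))" using that by (simp add: borel_eq_box)
  next
    fix A assume "A \<in> sigma_sets UNIV (range (\<lambda>(a, b). box a b :: 'a set))"
      and IH: "(LINT x|lborel. indicator A x * ?G x) = 0"
    then have A: "A \<in> sets borel" by (simp add: borel_eq_box)
    \<comment> \<open>The whole space is not a box, but \<open>?G\<close> vanishes off
      \<open>box a b\<close>, so its total integral is the instance for that box. Complements follow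
      by subtraction.\<close>
    have "(LINT x|lborel. ?G x) = 0"
      using box[of a b] by (simp add: mult.assoc[symmetric] indicator_inter_arith[symmetric])
    moreover have "(\<lambda>x. indicator (UNIV - A) x * ?G x) = (\<lambda>x. ?G x - indicator A x * ?G x)"
      by (auto simp: indicator_def)
    ultimately show "(LINT x|lborel. indicator (UNIV - A) x * ?G x) = 0"
      using IH G GA[OF A] by simp
  next
    fix A :: "nat \<Rightarrow> 'a set"
    assume dis: "disjoint_family A" and sub: "range A \<subseteq> sigma_sets UNIV (range (\<lambda>(a, b). box a b))"
      and IH: "\<And>i. (LINT x|lborel. indicator (A i) x * ?G x) = 0"
    have A: "A i \<in> sets borel" for i using sub by (auto simp: borel_eq_box)
    have "(LINT x:(\<Union>i. A i)|lborel. ?G x) = (\<Sum>i. (LINT x:(A i)|lborel. ?G x))"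
      using A dis GA[of "\<Union>i. A i"]
      by (intro lebesgue_integral_countable_add) (auto simp: disjoint_family_on_def set_integrable_def)
    then show "(LINT x|lborel. indicator (\<Union>i. A i) x * ?G x) = 0"
      using IH by (simp add: set_lebesgue_integral_def)
  qed (use box in auto)
  have "AE x in lborel. ?G x = 0"
    using G all by (intro density_unique_real) (auto simp: set_lebesgue_integral_def)
  then show ?thesis by eventually_elim auto
qed

text \<open>Orthogonality to the bumps passes, by dominated convergence with bound |D|, to the
  indicator of every box whose closed box lies in \<open>\<Omega>\<close>. Such boxes cover the open
  set, and countably many of them suffice.\<close>

lemma AE_zero_if_orthogonal_test_functions:
  fixes D :: "'a::euclidean_space \<Rightarrow> real"
  assumes "open \<Omega>" and D: "integrable (lebesgue_on \<Omega>) D"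
    and orth: "\<And>\<phi>. \<phi> \<in> test_functions \<Omega> \<Longrightarrow> l2_inner (lebesgue_on \<Omega>) D \<phi> = 0"
  shows "AE x in lebesgue_on \<Omega>. D x = 0"
proof -
  have \<Omega>: "\<Omega> \<in> sets lebesgue" using \<open>open \<Omega>\<close> by auto
  let ?F = "\<lambda>x. if x \<in> \<Omega> then D x else 0"
  have F: "integrable lebesgue ?F"
    using D Lebesgue_Measure.integrable_restrict_UNIV[OF \<Omega>] by blast
  \<comment> \<open>Boxes generate the Borel sets only, whereas \<open>?F\<close> is merely Lebesgue
    measurable; the argument therefore runs on a Borel representative.\<close>
  then obtain g where gm: "g \<in> borel_measurable lborel" and gF: "AE x in lborel. ?F x = g x"
    using completion_ex_borel_measurable_real[of ?F lborel] by auto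
  have gF': "AE x in lebesgue. ?F x = g x" by (rule AE_completion[OF gF])
  have gm': "g \<in> borel_measurable lebesgue" using gm by (rule measurable_completion)
  have "integrable lebesgue g"
    by (rule integrable_cong_AE_imp[OF F gm']) (use gF' in \<open>auto elim: eventually_mono\<close>)
  then have g: "integrable lborel g" using integrable_completion[OF gm] by simp
  have zero: "(LINT x|lborel. indicator (box p q) x * g x) = 0" if sub: "cbox p q \<subseteq> \<Omega>" for p q
  proof -
    have "(\<lambda>n. LINT x|lebesgue_on \<Omega>. D x * box_bump p q (real (Suc n)) x)
        \<longlonglongrightarrow> (LINT x|lebesgue_on \<Omega>. D x * indicator (box p q) x)"
    proof (rule integral_dominated_convergence[where w = "\<lambda>x. \<bar>D x\<bar>"])
      show "(\<lambda>x. D x * box_bump p q (real (Suc n)) x) \<in> borel_measurable (lebesgue_on \<Omega>)" for n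
        using D borel_measurable_lebesgue_on_continuous[OF C_infinity_continuous[OF box_bump_C_infinity]]
        by (intro borel_measurable_times) auto
      have "indicator (box p q) \<in> borel_measurable (lebesgue_on \<Omega>)"
        by (intro measurable_restrict_space1 measurable_completion) simp
      then show "(\<lambda>x. D x * indicator (box p q) x) \<in> borel_measurable (lebesgue_on \<Omega>)"
        using D by (intro borel_measurable_times) auto
      show "AE x in lebesgue_on \<Omega>. (\<lambda>n. D x * box_bump p q (real (Suc n)) x)
          \<longlonglongrightarrow> D x * indicator (box p q) x"
        by (intro AE_I2 tendsto_mult_left box_bump_tendsto)
      show "AE x in lebesgue_on \<Omega>. norm (D x * box_bump p q (real (Suc n)) x) \<le> \<bar>D x\<bar>" for n
        by (intro AE_I2) (simp add: abs_mult box_bump_bounds mult_left_le del: of_nat_Suc)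
    qed (use D in simp)
    moreover have "(LINT x|lebesgue_on \<Omega>. D x * box_bump p q (real (Suc n)) x) = 0" for n
      using orth[OF box_bump_test_function[OF _ sub]] by (simp add: l2_inner_def)
    ultimately have "0 = (LINT x|lebesgue_on \<Omega>. D x * indicator (box p q) x)"
      by (simp add: LIMSEQ_const_iff)
    also have "\<dots> = (LINT x|lebesgue. indicator \<Omega> x *\<^sub>R (D x * indicator (box p q) x))"
      using \<Omega> by (intro integral_restrict_space) simp
    also have "\<dots> = (LINT x|lebesgue. indicator (box p q) x * g x)"
    proof (rule integral_cong_AE)
      show ind: "(\<lambda>x. indicator (box p q) x * g x) \<in> borel_measurable lebesgue"
        using gm by (intro measurable_completion) simp
      show ae: "AE x in lebesgue. indicator \<Omega> x *\<^sub>R (D x * indicator (box p q) x) = indicator (box p q) x * g x"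
        using gF' by eventually_elim (auto simp: indicator_def split: if_splits)
      show "(\<lambda>x. indicator \<Omega> x *\<^sub>R (D x * indicator (box p q) x)) \<in> borel_measurable lebesgue"
        by (rule borel_measurable_AE[OF ind]) (use ae in \<open>auto elim: eventually_mono\<close>)
    qed
    also have "\<dots> = (LINT x|lborel. indicator (box p q) x * g x)"
      using gm by (intro integral_completion) simp
    finally show ?thesis by simp
  qed
  let ?\<F> = "{box a b | a b. cbox a b \<subseteq> \<Omega>}"
  have cover: "\<Union>?\<F> = \<Omega>"
  proof
    show "\<Union>?\<F> \<subseteq> \<Omega>" using box_subset_cbox by blast
    show "\<Omega> \<subseteq> \<Union>?\<F>"
    proof
      fix x assume "x \<in> \<Omega>"
      with \<open>open \<Omega>\<close> obtain a b where "cbox a b \<subseteq> \<Omega>" "x \<in> box a b" by (rule open_contains_cbox)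
      then show "x \<in> \<Union>?\<F>" by blast
    qed
  qed
  \<comment> \<open>A countable subcover keeps the union of the exceptional null sets a null
    set.\<close>
  obtain \<C> where \<C>: "\<C> \<subseteq> ?\<F>" "countable \<C>" "\<Union>\<C> = \<Union>?\<F>"
    by (rule Lindelof[of ?\<F>]) (auto simp: open_box)
  have "AE x in lborel. \<forall>B\<in>\<C>. x \<in> B \<longrightarrow> g x = 0"
  proof (rule AE_ball_countable[OF \<C>(2), THEN iffD2], rule ballI)
    fix B assume "B \<in> \<C>"
    then obtain a b where ab: "B = box a b" "cbox a b \<subseteq> \<Omega>" using \<C>(1) by auto
    show "AE x in lborel. x \<in> B \<longrightarrow> g x = 0"
      unfolding ab(1) by (rule AE_zero_if_box_integrals_zero[OF g]) (use zero ab(2) in auto)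
  qed
  then have "AE x in lebesgue. \<forall>B\<in>\<C>. x \<in> B \<longrightarrow> g x = 0" by (rule AE_completion)
  then have "AE x in lebesgue. x \<in> \<Omega> \<longrightarrow> D x = 0"
    using gF'
  proof eventually_elim
    case (elim x)
    show ?case
    proof
      assume "x \<in> \<Omega>"
      then obtain B where "B \<in> \<C>" "x \<in> B" using cover \<C>(3) by blast
      with elim \<open>x \<in> \<Omega>\<close> show "D x = 0" by auto
    qed
  qed
  then show ?thesis using \<Omega> by (simp add: AE_restrict_space_iff)
qed

section \<open>The Sobolev space of a bounded open set\<close>

text \<open>Boundedness of \<open>S\<close> gives a compact closure, hence a bound on
  \<open>f\<close>, and finite measure.\<close>

lemma L2_continuous:
  fixes f :: "'a::euclidean_space \<Rightarrow> real"
  assumes "bounded S" "S \<in> sets lebesgue" "continuous_on UNIV f"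
  shows "f \<in> L2 (lebesgue_on S)"
proof -
  interpret finite_measure "lebesgue_on S"
    using assms(1,2) by (intro finite_measure_lebesgue_on bounded_set_imp_lmeasurable)
  have "compact (f ` closure S)"
    using assms by (intro compact_continuous_image) (auto intro: continuous_on_subset)
  then have "bounded (f ` closure S)" by (rule compact_imp_bounded)
  then obtain C where "\<And>x. x \<in> closure S \<Longrightarrow> \<bar>f x\<bar> \<le> C"
    by (auto simp: bounded_iff)
  then show ?thesis
    using assms(3) closure_subset[of S]
    by (intro L2_bounded[where C = C] borel_measurable_lebesgue_on_continuous) auto
qed

lemma C_infinity_L2:
  fixes \<phi> :: "'a::euclidean_space \<Rightarrow> real"
  assumes "bounded S" "S \<in> sets lebesgue" "\<phi> \<in> C_infinity"
  shows "\<phi> \<in> L2 (lebesgue_on S)" and "b \<in> Basis \<Longrightarrow> partial_deriv b \<phi> \<in> L2 (lebesgue_on S)"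
  using C_infinity_continuous[OF assms(3)] C_infinity_partial_deriv_continuous[OF assms(3)]
  by (auto intro!: L2_continuous assms)

lemma weak_gradient:
  assumes "f \<in> H1 \<Omega>"
  shows "f \<in> L2 (lebesgue_on \<Omega>)" "has_weak_gradient \<Omega> f (weak_gradient \<Omega> f)"
  using assms someI_ex[of "has_weak_gradient \<Omega> f"] unfolding H1_def weak_gradient_def by auto

lemma has_weak_gradient_inner_integrable:
  assumes "has_weak_gradient \<Omega> f F" "has_weak_gradient \<Omega> g G"
  shows "integrable (lebesgue_on \<Omega>) (\<lambda>x. F x \<bullet> G x)"
proof -
  have "integrable (lebesgue_on \<Omega>) (\<lambda>x. \<Sum>b\<in>Basis. (F x \<bullet> b) * (G x \<bullet> b))"
    using assms by (intro Bochner_Integration.integrable_sum L2_mult_integrable)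
      (auto simp: has_weak_gradient_def)
  then show ?thesis by (simp add: euclidean_inner[symmetric])
qed

lemma dirichlet_form_commute: "dirichlet_form \<Omega> u v = dirichlet_form \<Omega> v u"
  by (simp add: dirichlet_form_def inner_commute)

lemma dirichlet_form_nonneg: "0 \<le> dirichlet_form \<Omega> u u"
  by (simp add: dirichlet_form_def)

lemma l2_norm_le_h1_norm: "l2_norm (lebesgue_on \<Omega>) u \<le> h1_norm \<Omega> u"
  unfolding h1_norm_def using dirichlet_form_nonneg[of \<Omega> u] by (intro real_le_rsqrt) simp

context
  fixes \<Omega> :: "'a::euclidean_space set"
  assumes open_\<Omega>: "open \<Omega>" and bounded_\<Omega>: "bounded \<Omega>"
begin

lemma sets_\<Omega>: "\<Omega> \<in> sets lebesgue"
  using open_\<Omega> by auto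

lemma test_function_L2:
  assumes "\<phi> \<in> test_functions \<Omega>"
  shows "\<phi> \<in> L2 (lebesgue_on \<Omega>)" "b \<in> Basis \<Longrightarrow> partial_deriv b \<phi> \<in> L2 (lebesgue_on \<Omega>)"
  using C_infinity_L2[OF bounded_\<Omega> sets_\<Omega>] assms by (auto simp: test_functions_def)

lemma has_weak_gradient_comb:
  assumes f: "f \<in> L2 (lebesgue_on \<Omega>)" "has_weak_gradient \<Omega> f F"
    and g: "g \<in> L2 (lebesgue_on \<Omega>)" "has_weak_gradient \<Omega> g G"
  shows "has_weak_gradient \<Omega> (\<lambda>x. \<alpha> * f x + \<beta> * g x) (\<lambda>x. \<alpha> *\<^sub>R F x + \<beta> *\<^sub>R G x)"
  unfolding has_weak_gradient_def
proof (intro ballI conjI)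
  fix b :: 'a assume b: "b \<in> Basis"
  have FG: "(\<lambda>x. F x \<bullet> b) \<in> L2 (lebesgue_on \<Omega>)" "(\<lambda>x. G x \<bullet> b) \<in> L2 (lebesgue_on \<Omega>)"
    using f(2) g(2) b by (auto simp: has_weak_gradient_def)
  have eq: "(\<lambda>x. (\<alpha> *\<^sub>R F x + \<beta> *\<^sub>R G x) \<bullet> b) = (\<lambda>x. \<alpha> * (F x \<bullet> b) + \<beta> * (G x \<bullet> b))"
    by (simp add: inner_add_left)
  show "(\<lambda>x. (\<alpha> *\<^sub>R F x + \<beta> *\<^sub>R G x) \<bullet> b) \<in> L2 (lebesgue_on \<Omega>)"
    unfolding eq by (rule L2_comb[OF FG])
  fix \<phi> assume \<phi>: "\<phi> \<in> test_functions \<Omega>"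
  have "l2_inner (lebesgue_on \<Omega>) f (partial_deriv b \<phi>) = - l2_inner (lebesgue_on \<Omega>) (\<lambda>x. F x \<bullet> b) \<phi>"
    "l2_inner (lebesgue_on \<Omega>) g (partial_deriv b \<phi>) = - l2_inner (lebesgue_on \<Omega>) (\<lambda>x. G x \<bullet> b) \<phi>"
    using f(2) g(2) b \<phi> by (auto simp: has_weak_gradient_def)
  then show "l2_inner (lebesgue_on \<Omega>) (\<lambda>x. \<alpha> * f x + \<beta> * g x) (partial_deriv b \<phi>)
      = - l2_inner (lebesgue_on \<Omega>) (\<lambda>x. (\<alpha> *\<^sub>R F x + \<beta> *\<^sub>R G x) \<bullet> b) \<phi>"
    unfolding eq l2_inner_comb_left[OF FG test_function_L2(1)[OF \<phi>]]
      l2_inner_comb_left[OF f(1) g(1) test_function_L2(2)[OF \<phi> b]]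
    by simp
qed

text \<open>In each coordinate both candidates have the same inner product with every test function,
  so the fundamental lemma applies to their difference.\<close>

lemma has_weak_gradient_unique:
  assumes F: "has_weak_gradient \<Omega> f F" and G: "has_weak_gradient \<Omega> f G"
  shows "AE x in lebesgue_on \<Omega>. F x = G x"
proof -
  interpret finite_measure "lebesgue_on \<Omega>"
    using bounded_\<Omega> sets_\<Omega> by (intro finite_measure_lebesgue_on bounded_set_imp_lmeasurable)
  have "AE x in lebesgue_on \<Omega>. \<forall>b\<in>Basis. 1 * (F x \<bullet> b) + -1 * (G x \<bullet> b) = 0"
  proof (rule AE_ball_countable[THEN iffD2])
    show "\<forall>b\<in>Basis. AE x in lebesgue_on \<Omega>. 1 * (F x \<bullet> b) + -1 * (G x \<bullet> b) = 0"
    proof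
      fix b :: 'a assume b: "b \<in> Basis"
      have FG: "(\<lambda>x. F x \<bullet> b) \<in> L2 (lebesgue_on \<Omega>)" "(\<lambda>x. G x \<bullet> b) \<in> L2 (lebesgue_on \<Omega>)"
        using F G b by (auto simp: has_weak_gradient_def)
      \<comment> \<open>The fundamental lemma wants an integrable function; on a set of finite
        measure an L2 function is integrable, being its own product with 1.\<close>
      have "(\<lambda>_. 1) \<in> L2 (lebesgue_on \<Omega>)" by (intro L2_bounded) auto
      from L2_mult_integrable[OF L2_comb[OF FG] this, of 1 "-1"]
      have int: "integrable (lebesgue_on \<Omega>) (\<lambda>x. 1 * (F x \<bullet> b) + -1 * (G x \<bullet> b))" by simp
      show "AE x in lebesgue_on \<Omega>. 1 * (F x \<bullet> b) + -1 * (G x \<bullet> b) = 0"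
      proof (rule AE_zero_if_orthogonal_test_functions[OF open_\<Omega> int])
        fix \<phi> assume \<phi>: "\<phi> \<in> test_functions \<Omega>"
        then have "l2_inner (lebesgue_on \<Omega>) f (partial_deriv b \<phi>) = - l2_inner (lebesgue_on \<Omega>) (\<lambda>x. F x \<bullet> b) \<phi>"
          "l2_inner (lebesgue_on \<Omega>) f (partial_deriv b \<phi>) = - l2_inner (lebesgue_on \<Omega>) (\<lambda>x. G x \<bullet> b) \<phi>"
          using F G b by (auto simp: has_weak_gradient_def)
        then show "l2_inner (lebesgue_on \<Omega>) (\<lambda>x. 1 * (F x \<bullet> b) + -1 * (G x \<bullet> b)) \<phi> = 0"
          unfolding l2_inner_comb_left[OF FG test_function_L2(1)[OF \<phi>]] by simp
      qed
    qed
  qed (simp add: countable_finite)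
  then show ?thesis by eventually_elim (auto intro: euclidean_eqI)
qed

lemma H1_comb:
  assumes "f \<in> H1 \<Omega>" "g \<in> H1 \<Omega>"
  shows "(\<lambda>x. \<alpha> * f x + \<beta> * g x) \<in> H1 \<Omega>"
  using L2_comb has_weak_gradient_comb weak_gradient[OF assms(1)] weak_gradient[OF assms(2)]
  unfolding H1_def by blast

text \<open>The choices made for the combination and for its two terms are unrelated, but both sides
  are weak gradients of the same function.\<close>

lemma weak_gradient_comb:
  assumes "f \<in> H1 \<Omega>" "g \<in> H1 \<Omega>"
  shows "AE x in lebesgue_on \<Omega>. weak_gradient \<Omega> (\<lambda>x. \<alpha> * f x + \<beta> * g x) x
    = \<alpha> *\<^sub>R weak_gradient \<Omega> f x + \<beta> *\<^sub>R weak_gradient \<Omega> g x"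
  by (rule has_weak_gradient_unique[OF weak_gradient(2)[OF H1_comb[OF assms]]])
    (intro has_weak_gradient_comb weak_gradient assms)

text \<open>The chosen gradients combine almost everywhere, which the integral does not distinguish
  from equality.\<close>

lemma dirichlet_form_comb_left:
  assumes u: "u \<in> H1 \<Omega>" and v: "v \<in> H1 \<Omega>" and w: "w \<in> H1 \<Omega>"
  shows "dirichlet_form \<Omega> (\<lambda>x. \<alpha> * u x + \<beta> * v x) w
    = \<alpha> * dirichlet_form \<Omega> u w + \<beta> * dirichlet_form \<Omega> v w"
proof -
  let ?G = "weak_gradient \<Omega>"
  note int = has_weak_gradient_inner_integrable[OF weak_gradient(2) weak_gradient(2)[OF w]]
  have "dirichlet_form \<Omega> (\<lambda>x. \<alpha> * u x + \<beta> * v x) w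
      = (LINT x|lebesgue_on \<Omega>. \<alpha> * (?G u x \<bullet> ?G w x) + \<beta> * (?G v x \<bullet> ?G w x))"
    unfolding dirichlet_form_def
  proof (rule integral_cong_AE)
    show "(\<lambda>x. ?G (\<lambda>x. \<alpha> * u x + \<beta> * v x) x \<bullet> ?G w x) \<in> borel_measurable (lebesgue_on \<Omega>)"
      using int[OF H1_comb[OF u v]] by (rule borel_measurable_integrable)
    show "(\<lambda>x. \<alpha> * (?G u x \<bullet> ?G w x) + \<beta> * (?G v x \<bullet> ?G w x)) \<in> borel_measurable (lebesgue_on \<Omega>)"
      using int[OF u] int[OF v] by (intro borel_measurable_integrable) simp
    show "AE x in lebesgue_on \<Omega>. ?G (\<lambda>x. \<alpha> * u x + \<beta> * v x) x \<bullet> ?G w x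
        = \<alpha> * (?G u x \<bullet> ?G w x) + \<beta> * (?G v x \<bullet> ?G w x)"
      using weak_gradient_comb[OF u v, of \<alpha> \<beta>] by eventually_elim (simp add: inner_add_left)
  qed
  then show ?thesis using int[OF u] int[OF v] by (simp add: dirichlet_form_def)
qed

lemma H1_seminormed: "seminormed_functions (H1 \<Omega>) (h1_norm \<Omega>)"
proof -
  have "seminormed_functions (H1 \<Omega>)
      (\<lambda>u. sqrt (l2_inner (lebesgue_on \<Omega>) u u + dirichlet_form \<Omega> u u))"
  proof (rule seminormed_functionsI_inner(1)[where
        B = "\<lambda>u v. l2_inner (lebesgue_on \<Omega>) u v + dirichlet_form \<Omega> u v"])
    fix u v w \<alpha> \<beta> assume uvw: "u \<in> H1 \<Omega>" "v \<in> H1 \<Omega>" "w \<in> H1 \<Omega>"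
    show "l2_inner (lebesgue_on \<Omega>) (\<lambda>x. \<alpha> * u x + \<beta> * v x) w + dirichlet_form \<Omega> (\<lambda>x. \<alpha> * u x + \<beta> * v x) w
        = \<alpha> * (l2_inner (lebesgue_on \<Omega>) u w + dirichlet_form \<Omega> u w)
          + \<beta> * (l2_inner (lebesgue_on \<Omega>) v w + dirichlet_form \<Omega> v w)"
      unfolding dirichlet_form_comb_left[OF uvw]
        l2_inner_comb_left[OF uvw[THEN weak_gradient(1)]]
      by (simp add: algebra_simps)
  next
    show "l2_inner (lebesgue_on \<Omega>) u v + dirichlet_form \<Omega> u v
      = l2_inner (lebesgue_on \<Omega>) v u + dirichlet_form \<Omega> v u" for u v
      by (simp only: l2_inner_commute[of _ u] dirichlet_form_commute[of _ u])
  qed (auto intro: H1_comb add_nonneg_nonneg l2_inner_self_nonneg dirichlet_form_nonneg)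
  then show ?thesis
    by (simp add: h1_norm_def[abs_def] l2_norm_power2)
qed

section \<open>Traces and the subspace with zero trace on a part of the boundary\<close>

lemma has_trace_comb:
  assumes u: "has_trace \<Omega> u p" and v: "has_trace \<Omega> v q"
  shows "has_trace \<Omega> (\<lambda>x. \<alpha> * u x + \<beta> * v x) (\<lambda>x. \<alpha> * p x + \<beta> * q x)"
proof -
  let ?S = "surface_on (frontier \<Omega>)"
  interpret H: seminormed_functions "H1 \<Omega>" "h1_norm \<Omega>" by (rule H1_seminormed)
  \<comment> \<open>Stated for an arbitrary seminorm because it is needed twice: for the H1 norm of
    the functions and for the L2 norm of their boundary values.\<close>
  have lim: "(\<lambda>k. N (\<lambda>x. \<alpha> * \<phi> k x + \<beta> * \<psi> k x - (\<alpha> * u x + \<beta> * v x))) \<longlonglongrightarrow> 0"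
    if "seminormed_functions X N" and mem: "\<And>k. \<phi> k \<in> X" "\<And>k. \<psi> k \<in> X" "u \<in> X" "v \<in> X"
      and lims: "(\<lambda>k. N (\<lambda>x. \<phi> k x - u x)) \<longlonglongrightarrow> 0" "(\<lambda>k. N (\<lambda>x. \<psi> k x - v x)) \<longlonglongrightarrow> 0"
    for X and N :: "('a \<Rightarrow> real) \<Rightarrow> real" and \<phi> \<psi> :: "nat \<Rightarrow> 'a \<Rightarrow> real" and u v
  proof -
    interpret seminormed_functions X N by fact
    have eq: "(\<lambda>x. \<alpha> * \<phi> k x + \<beta> * \<psi> k x - (\<alpha> * u x + \<beta> * v x))
        = (\<lambda>x. \<alpha> * (\<phi> k x - u x) + \<beta> * (\<psi> k x - v x))" for k
      by (simp add: algebra_simps)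
    note dm = diff_mem[OF mem(1,3)] diff_mem[OF mem(2,4)]
    show ?thesis
    proof (rule Lim_null_comparison[OF always_eventually])
      show "\<forall>k. norm (N (\<lambda>x. \<alpha> * \<phi> k x + \<beta> * \<psi> k x - (\<alpha> * u x + \<beta> * v x)))
          \<le> \<bar>\<alpha>\<bar> * N (\<lambda>x. \<phi> k x - u x) + \<bar>\<beta>\<bar> * N (\<lambda>x. \<psi> k x - v x)"
        unfolding eq using comb_le[OF dm] nonneg[OF comb_mem[OF dm]] by simp
      show "(\<lambda>k. \<bar>\<alpha>\<bar> * N (\<lambda>x. \<phi> k x - u x) + \<bar>\<beta>\<bar> * N (\<lambda>x. \<psi> k x - v x)) \<longlonglongrightarrow> 0"
        by (rule tendsto_eq_intros tendsto_const lims refl)+ simp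
    qed
  qed
  obtain \<phi> where \<phi>: "\<And>k. \<phi> k \<in> C_infinity \<inter> H1 \<Omega> \<inter> L2 ?S"
      "(\<lambda>k. h1_norm \<Omega> (\<lambda>x. \<phi> k x - u x)) \<longlonglongrightarrow> 0" "(\<lambda>k. l2_norm ?S (\<lambda>x. \<phi> k x - p x)) \<longlonglongrightarrow> 0"
    using u unfolding has_trace_def by blast
  obtain \<psi> where \<psi>: "\<And>k. \<psi> k \<in> C_infinity \<inter> H1 \<Omega> \<inter> L2 ?S"
      "(\<lambda>k. h1_norm \<Omega> (\<lambda>x. \<psi> k x - v x)) \<longlonglongrightarrow> 0" "(\<lambda>k. l2_norm ?S (\<lambda>x. \<psi> k x - q x)) \<longlonglongrightarrow> 0"
    using v unfolding has_trace_def by blast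
  show ?thesis
    unfolding has_trace_def
  proof (intro conjI exI allI)
    show "(\<lambda>x. \<alpha> * u x + \<beta> * v x) \<in> H1 \<Omega>" "(\<lambda>x. \<alpha> * p x + \<beta> * q x) \<in> L2 ?S"
      using u v by (auto simp: has_trace_def intro: H.comb_mem L2.comb_mem)
    show "(\<lambda>x. \<alpha> * \<phi> k x + \<beta> * \<psi> k x) \<in> C_infinity \<inter> H1 \<Omega> \<inter> L2 ?S" for k
      using \<phi>(1)[of k] \<psi>(1)[of k] by (auto intro: C_infinity_comb H.comb_mem L2.comb_mem)
    show "(\<lambda>k. h1_norm \<Omega> (\<lambda>x. \<alpha> * \<phi> k x + \<beta> * \<psi> k x - (\<alpha> * u x + \<beta> * v x))) \<longlonglongrightarrow> 0"
      by (rule lim[OF H.seminormed_functions_axioms _ _ _ _ \<phi>(2) \<psi>(2)])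
        (use \<phi>(1) \<psi>(1) u v in \<open>auto simp: has_trace_def\<close>)
    show "(\<lambda>k. l2_norm ?S (\<lambda>x. \<alpha> * \<phi> k x + \<beta> * \<psi> k x - (\<alpha> * p x + \<beta> * q x))) \<longlonglongrightarrow> 0"
      by (rule lim[OF L2.seminormed_functions_axioms _ _ _ _ \<phi>(3) \<psi>(3)])
        (use \<phi>(1) \<psi>(1) u v in \<open>auto simp: has_trace_def\<close>)
  qed
qed

lemma H1_zero_on_comb:
  assumes "u \<in> H1_zero_on \<Omega> \<Gamma>" "v \<in> H1_zero_on \<Omega> \<Gamma>"
  shows "(\<lambda>x. \<alpha> * u x + \<beta> * v x) \<in> H1_zero_on \<Omega> \<Gamma>"
proof -
  obtain p q where pq: "has_trace \<Omega> u p" "AE x in surface_on \<Gamma>. p x = 0"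
      "has_trace \<Omega> v q" "AE x in surface_on \<Gamma>. q x = 0"
    using assms by (auto simp: H1_zero_on_def has_trace_on_def)
  have "AE x in surface_on \<Gamma>. \<alpha> * p x + \<beta> * q x = 0"
    using pq(2,4) by eventually_elim simp
  then have "has_trace_on \<Omega> \<Gamma> (\<lambda>x. \<alpha> * u x + \<beta> * v x) (\<lambda>_. 0)"
    unfolding has_trace_on_def using has_trace_comb[OF pq(1,3)] by blast
  then show ?thesis using assms by (auto simp: H1_zero_on_def intro: H1_comb)
qed

lemma H1_zero_on_seminormed: "seminormed_functions (H1_zero_on \<Omega> \<Gamma>) (h1_norm \<Omega>)"
  by (rule seminormed_functions.subspace[OF H1_seminormed _ H1_zero_on_comb])
    (auto simp: H1_zero_on_def)

end

section \<open>Affine dependence of the state on the control\<close>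

lemma continuous_into_L2_comb:
  assumes u: "continuous_into_L2 T M u" and v: "continuous_into_L2 T M v"
  shows "continuous_into_L2 T M (\<lambda>t x. \<alpha> * u t x + \<beta> * v t x)"
  unfolding continuous_into_L2_def
proof (intro ballI conjI)
  fix s assume s: "s \<in> {0..T}"
  have mem: "u t \<in> L2 M" "v t \<in> L2 M" if "t \<in> {0..T}" for t
    using u v that by (auto simp: continuous_into_L2_def)
  show "(\<lambda>x. \<alpha> * u s x + \<beta> * v s x) \<in> L2 M" using mem[OF s] by (rule L2_comb)
  have lims: "((\<lambda>t. l2_norm M (\<lambda>x. u t x - u s x)) \<longlongrightarrow> 0) (at s within {0..T})"
      "((\<lambda>t. l2_norm M (\<lambda>x. v t x - v s x)) \<longlongrightarrow> 0) (at s within {0..T})"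
    using u v s by (auto simp: continuous_into_L2_def)
  have eq: "(\<lambda>x. \<alpha> * u t x + \<beta> * v t x - (\<alpha> * u s x + \<beta> * v s x))
      = (\<lambda>x. \<alpha> * (u t x - u s x) + \<beta> * (v t x - v s x))" for t
    by (simp add: algebra_simps)
  have le: "norm (l2_norm M (\<lambda>x. \<alpha> * u t x + \<beta> * v t x - (\<alpha> * u s x + \<beta> * v s x)))
      \<le> \<bar>\<alpha>\<bar> * l2_norm M (\<lambda>x. u t x - u s x) + \<bar>\<beta>\<bar> * l2_norm M (\<lambda>x. v t x - v s x)"
    if t: "t \<in> {0..T}" for t
  proof -
    note dm = L2.diff_mem[OF mem(1)[OF t] mem(1)[OF s]] L2.diff_mem[OF mem(2)[OF t] mem(2)[OF s]]
    show ?thesis unfolding eq using L2.comb_le[OF dm] L2.nonneg[OF L2.comb_mem[OF dm]] by simp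
  qed
  show "((\<lambda>t. l2_norm M (\<lambda>x. \<alpha> * u t x + \<beta> * v t x - (\<alpha> * u s x + \<beta> * v s x))) \<longlongrightarrow> 0)
      (at s within {0..T})"
  proof (rule Lim_null_comparison)
    show "\<forall>\<^sub>F t in at s within {0..T}. norm (l2_norm M (\<lambda>x. \<alpha> * u t x + \<beta> * v t x - (\<alpha> * u s x + \<beta> * v s x)))
        \<le> \<bar>\<alpha>\<bar> * l2_norm M (\<lambda>x. u t x - u s x) + \<bar>\<beta>\<bar> * l2_norm M (\<lambda>x. v t x - v s x)"
      unfolding eventually_at_filter using le by (intro always_eventually) blast
    show "((\<lambda>t. \<bar>\<alpha>\<bar> * l2_norm M (\<lambda>x. u t x - u s x) + \<bar>\<beta>\<bar> * l2_norm M (\<lambda>x. v t x - v s x)) \<longlongrightarrow> 0)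
        (at s within {0..T})"
      by (rule tendsto_eq_intros tendsto_const lims refl)+ simp
  qed
qed

lemma has_initial_value_comb:
  assumes u: "has_initial_value T M u u0" and v: "has_initial_value T M v v0"
  shows "has_initial_value T M (\<lambda>t x. \<alpha> * u t x + \<beta> * v t x) (\<lambda>x. \<alpha> * u0 x + \<beta> * v0 x)"
proof -
  obtain c d where c: "continuous_into_L2 T M c" "bochner_eq T M u c" "AE x in M. c 0 x = u0 x"
      and d: "continuous_into_L2 T M d" "bochner_eq T M v d" "AE x in M. d 0 x = v0 x"
    using u v by (auto simp: has_initial_value_def)
  have "bochner_eq T M (\<lambda>t x. \<alpha> * u t x + \<beta> * v t x) (\<lambda>t x. \<alpha> * c t x + \<beta> * d t x)"
    using c(2) d(2) unfolding bochner_eq_def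
  proof eventually_elim
    case (elim t)
    then show ?case by eventually_elim simp
  qed
  moreover have "AE x in M. \<alpha> * c 0 x + \<beta> * d 0 x = \<alpha> * u0 x + \<beta> * v0 x"
    using c(3) d(3) by eventually_elim simp
  ultimately show ?thesis
    unfolding has_initial_value_def
    using continuous_into_L2_comb[OF c(1) d(1), of \<alpha> \<beta>]
    by (intro exI[of _ "\<lambda>t x. \<alpha> * c t x + \<beta> * d t x"]) simp
qed

text \<open>The weak time derivative is written with \<open>deriv\<close>, smoothness with
  \<open>partial_deriv\<close>; on the real line the two agree at the only basis vector 1.\<close>

lemma test_function_time_L2:
  assumes "\<psi> \<in> test_functions {0<..<T}"
  shows "\<psi> \<in> L2 (time_interval T)" "deriv \<psi> \<in> L2 (time_interval T)"
proof -
  have \<psi>: "\<psi> \<in> C_infinity" using assms by (simp add: test_functions_def)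
  then have "C_upto 1 \<psi>" by (simp add: C_infinity_def)
  then have diff: "\<psi> differentiable (at t)" for t by simp
  have "deriv \<psi> t = partial_deriv 1 \<psi> t" for t
  proof -
    obtain D where "(\<psi> has_real_derivative D) (at t)"
      using diff[of t] by (auto simp: real_differentiable_def)
    then show ?thesis
      using partial_deriv_eq[OF has_field_derivative_imp_has_derivative]
      by (metis DERIV_imp_deriv mult.right_neutral)
  qed
  then have "deriv \<psi> = partial_deriv 1 \<psi>" by blast
  then show "\<psi> \<in> L2 (time_interval T)" "deriv \<psi> \<in> L2 (time_interval T)"
    using C_infinity_L2(1)[OF _ _ \<psi>, of "{0<..<T}"] C_infinity_L2(2)[OF _ _ \<psi>, of "{0<..<T}" 1]
    by auto
qed

lemma l2_inner_time_L2:
  assumes "u \<in> L2_L2 T M" "f \<in> L2 M"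
  shows "(\<lambda>t. l2_inner M (u t) f) \<in> L2 (time_interval T)"
proof (rule L2.bochner_L2_functional[OF assms(1)])
  show "l2_inner M (\<lambda>x. p x - q x) f = l2_inner M p f - l2_inner M q f"
    if "p \<in> L2 M" "q \<in> L2 M" for p q
    using l2_inner_comb_left[OF that assms(2), of 1 "-1"] by simp
  show "\<bar>l2_inner M p f\<bar> \<le> l2_norm M f * l2_norm M p" if "p \<in> L2 M" for p
    using l2_inner_le[OF that assms(2)] by (simp add: mult.commute)
qed

text \<open>Evaluation at \<open>v\<close> is Lipschitz on the dual with constant
  \<open>N v\<close>.\<close>

lemma dual_pairing_time_L2:
  assumes "seminormed_functions X N" "v \<in> X"
    and F: "F \<in> bochner_L2 T (dual_space X N) (dual_norm X N)"
  shows "(\<lambda>t. F t v) \<in> L2 (time_interval T)"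
proof -
  interpret seminormed_functions X N by fact
  interpret D: seminormed_functions "dual_space X N" "dual_norm X N"
    using assms(2) by (intro dual_seminormed) auto
  show ?thesis
    by (rule D.bochner_L2_functional[OF F, of "\<lambda>G. G v" "N v"])
      (use dual_le[OF _ assms(2)] in \<open>auto simp: mult.commute\<close>)
qed

text \<open>The defining identity is linear, but splitting its integrals needs integrability in
  time. Square integrability of each factor supplies it.\<close>

lemma has_weak_time_derivative_comb:
  assumes X: "seminormed_functions X N" "X \<subseteq> L2 M"
    and u: "u \<in> L2_L2 T M" "F \<in> bochner_L2 T (dual_space X N) (dual_norm X N)"
      "has_weak_time_derivative T M X u F"
    and v: "v \<in> L2_L2 T M" "G \<in> bochner_L2 T (dual_space X N) (dual_norm X N)"
      "has_weak_time_derivative T M X v G"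
  shows "has_weak_time_derivative T M X (\<lambda>t x. \<alpha> * u t x + \<beta> * v t x) (\<lambda>t f. \<alpha> * F t f + \<beta> * G t f)"
  unfolding has_weak_time_derivative_def
proof (intro ballI)
  fix \<psi> f assume \<psi>: "\<psi> \<in> test_functions {0<..<T}" and f: "f \<in> X"
  note \<psi>L2 = test_function_time_L2[OF \<psi>]
  have fL2: "f \<in> L2 M" using f X(2) by auto
  let ?I = "time_interval T"
  have "(LINT t|?I. l2_inner M (\<lambda>x. \<alpha> * u t x + \<beta> * v t x) f * deriv \<psi> t)
      = (LINT t|?I. (\<alpha> * l2_inner M (u t) f + \<beta> * l2_inner M (v t) f) * deriv \<psi> t)"
  \<comment> \<open>The inner product splits only at those times at which both functions lie in
    L2.\<close>
  proof (rule integral_cong_AE)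
    show "(\<lambda>t. l2_inner M (\<lambda>x. \<alpha> * u t x + \<beta> * v t x) f * deriv \<psi> t) \<in> borel_measurable ?I"
      by (intro borel_measurable_integrable L2_mult_integrable \<psi>L2 l2_inner_time_L2 fL2
          L2.bochner_L2_comb u v)
    show "(\<lambda>t. (\<alpha> * l2_inner M (u t) f + \<beta> * l2_inner M (v t) f) * deriv \<psi> t) \<in> borel_measurable ?I"
      by (intro borel_measurable_integrable L2_mult_integrable \<psi>L2 L2_comb l2_inner_time_L2 fL2 u v)
    show "AE t in ?I. l2_inner M (\<lambda>x. \<alpha> * u t x + \<beta> * v t x) f * deriv \<psi> t
        = (\<alpha> * l2_inner M (u t) f + \<beta> * l2_inner M (v t) f) * deriv \<psi> t"
      using L2.bochner_L2_mem[OF u(1)] L2.bochner_L2_mem[OF v(1)]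
      by eventually_elim (simp add: l2_inner_comb_left fL2)
  qed
  \<comment> \<open>Reading the time integral as an inner product over the interval lets the
    bilinearity of \<open>l2_inner\<close> do the splitting.\<close>
  also have "\<dots> = l2_inner ?I (\<lambda>t. \<alpha> * l2_inner M (u t) f + \<beta> * l2_inner M (v t) f) (deriv \<psi>)"
    by (simp add: l2_inner_def)
  also have "\<dots> = \<alpha> * l2_inner ?I (\<lambda>t. l2_inner M (u t) f) (deriv \<psi>)
      + \<beta> * l2_inner ?I (\<lambda>t. l2_inner M (v t) f) (deriv \<psi>)"
    by (intro l2_inner_comb_left l2_inner_time_L2 u v fL2 \<psi>L2)
  also have "\<dots> = - (\<alpha> * l2_inner ?I (\<lambda>t. F t f) \<psi> + \<beta> * l2_inner ?I (\<lambda>t. G t f) \<psi>)"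
    using u(3) v(3) \<psi> f unfolding has_weak_time_derivative_def l2_inner_def by simp
  also have "\<alpha> * l2_inner ?I (\<lambda>t. F t f) \<psi> + \<beta> * l2_inner ?I (\<lambda>t. G t f) \<psi>
      = l2_inner ?I (\<lambda>t. \<alpha> * F t f + \<beta> * G t f) \<psi>"
    by (intro l2_inner_comb_left[symmetric] dual_pairing_time_L2[OF X(1) f] u v \<psi>L2)
  finally show "(LINT t|?I. l2_inner M (\<lambda>x. \<alpha> * u t x + \<beta> * v t x) f * deriv \<psi> t)
      = - (LINT t|?I. (\<alpha> * F t f + \<beta> * G t f) * \<psi> t)"
    by (simp add: l2_inner_def)
qed

section \<open>Solutions of the state equation\<close>

context
  fixes \<Omega> :: "'a::euclidean_space set" and v\<^sub>b :: "'a \<Rightarrow> real"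
  assumes open_\<Omega>: "open \<Omega>" and bounded_\<Omega>: "bounded \<Omega>" and vb: "v\<^sub>b \<in> H1 \<Omega>"
begin

interpretation H1: seminormed_functions "H1 \<Omega>" "h1_norm \<Omega>"
  by (rule H1_seminormed[OF open_\<Omega> bounded_\<Omega>])

interpretation V0: seminormed_functions "H1_zero_on \<Omega> \<Gamma>" "h1_norm \<Omega>" for \<Gamma>
  by (rule H1_zero_on_seminormed[OF open_\<Omega> bounded_\<Omega>])

text \<open>Only \<open>u - v\<^sub>b\<close> is controlled by definition. Adding back
  \<open>v\<^sub>b\<close>, constant in time on a bounded interval, places \<open>u\<close> itself
  where the Dirichlet form is linear.\<close>

lemma solves_heat_H1:
  assumes "solves_heat \<Omega> \<Gamma>1 \<Gamma>2 T g v\<^sub>b q u"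
  shows "u \<in> bochner_L2 T (H1 \<Omega>) (h1_norm \<Omega>)"
proof -
  have "(\<lambda>t x. u t x - v\<^sub>b x) \<in> bochner_L2 T (H1_zero_on \<Omega> \<Gamma>1) (h1_norm \<Omega>)"
    using assms by (simp add: solves_heat_def Let_def)
  then have "(\<lambda>t x. u t x - v\<^sub>b x) \<in> bochner_L2 T (H1 \<Omega>) (h1_norm \<Omega>)"
    by (rule V0.bochner_L2_mono[OF H1.seminormed_functions_axioms, rotated 2])
      (auto simp: H1_zero_on_def)
  from H1.bochner_L2_comb[OF this H1.bochner_L2_const[OF vb], of 1 1] show ?thesis by simp
qed

lemma solves_heat_L2:
  assumes "solves_heat \<Omega> \<Gamma>1 \<Gamma>2 T g v\<^sub>b q u"
  shows "u \<in> L2_L2 T (lebesgue_on \<Omega>)"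
  by (rule H1.bochner_L2_mono[OF L2.seminormed_functions_axioms _ _ solves_heat_H1[OF assms]])
    (auto simp: H1_def l2_norm_le_h1_norm)

text \<open>Coefficients with sum 1 reproduce \<open>g\<close> and \<open>v\<^sub>b\<close>. Both
  controls are multiples of one \<open>q\<close> because a scalar leaves an integral
  unconditionally, whereas a sum of two controls would first have to be shown integrable against the
  trace.\<close>

lemma solves_heat_affine:
  assumes u: "solves_heat \<Omega> \<Gamma>1 \<Gamma>2 T g v\<^sub>b (\<lambda>t x. \<kappa> * q t x) u"
    and v: "solves_heat \<Omega> \<Gamma>1 \<Gamma>2 T g v\<^sub>b (\<lambda>t x. \<mu> * q t x) v"
    and one: "\<alpha> + \<beta> = 1"
  shows "solves_heat \<Omega> \<Gamma>1 \<Gamma>2 T g v\<^sub>b (\<lambda>t x. (\<alpha> * \<kappa> + \<beta> * \<mu>) * q t x) (\<lambda>t x. \<alpha> * u t x + \<beta> * v t x)"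
proof -
  let ?H = "lebesgue_on \<Omega>" and ?V = "H1_zero_on \<Omega> \<Gamma>1"
  let ?D = "bochner_L2 T (dual_space ?V (h1_norm \<Omega>)) (dual_norm ?V (h1_norm \<Omega>))"
  let ?w = "\<lambda>t x. \<alpha> * u t x + \<beta> * v t x"
  have \<beta>: "\<beta> = 1 - \<alpha>" using one by simp
  obtain u' where u1: "(\<lambda>t x. u t x - v\<^sub>b x) \<in> bochner_L2 T ?V (h1_norm \<Omega>)"
      and u2: "has_initial_value T ?H u v\<^sub>b" and u3: "u' \<in> ?D"
      and u4: "has_weak_time_derivative T ?H ?V u u'"
      and u5: "AE t in time_interval T. \<forall>f\<in>?V. \<forall>p. has_trace \<Omega> f p \<longrightarrow>
            u' t f + dirichlet_form \<Omega> (u t) f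
            = l2_inner ?H (g t) f - l2_inner (surface_on \<Gamma>2) (\<lambda>x. \<kappa> * q t x) p"
    using u unfolding solves_heat_def Let_def by blast
  obtain v' where v1: "(\<lambda>t x. v t x - v\<^sub>b x) \<in> bochner_L2 T ?V (h1_norm \<Omega>)"
      and v2: "has_initial_value T ?H v v\<^sub>b" and v3: "v' \<in> ?D"
      and v4: "has_weak_time_derivative T ?H ?V v v'"
      and v5: "AE t in time_interval T. \<forall>f\<in>?V. \<forall>p. has_trace \<Omega> f p \<longrightarrow>
            v' t f + dirichlet_form \<Omega> (v t) f
            = l2_inner ?H (g t) f - l2_inner (surface_on \<Gamma>2) (\<lambda>x. \<mu> * q t x) p"
    using v unfolding solves_heat_def Let_def by blast
  have scale: "l2_inner N (\<lambda>x. c * f x) p = c * l2_inner N f p" for N :: "'a measure" and c f p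
    by (simp add: l2_inner_def mult.assoc)
  have w1: "(\<lambda>t x. ?w t x - v\<^sub>b x) \<in> bochner_L2 T ?V (h1_norm \<Omega>)"
  proof -
    have "(\<lambda>t x. \<alpha> * (u t x - v\<^sub>b x) + \<beta> * (v t x - v\<^sub>b x)) = (\<lambda>t x. ?w t x - v\<^sub>b x)"
      by (simp add: \<beta> algebra_simps)
    then show ?thesis using V0.bochner_L2_comb[OF u1 v1, of \<alpha> \<beta>] by simp
  qed
  have w2: "has_initial_value T ?H ?w v\<^sub>b"
  proof -
    have "(\<lambda>x. \<alpha> * v\<^sub>b x + \<beta> * v\<^sub>b x) = v\<^sub>b" by (simp add: \<beta> algebra_simps)
    then show ?thesis using has_initial_value_comb[OF u2 v2, of \<alpha> \<beta>] by simp
  qed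
  have VL2: "?V \<subseteq> L2 ?H" by (auto simp: H1_zero_on_def H1_def)
  have w4: "has_weak_time_derivative T ?H ?V ?w (\<lambda>t f. \<alpha> * u' t f + \<beta> * v' t f)"
    by (intro has_weak_time_derivative_comb[OF V0.seminormed_functions_axioms VL2]
        solves_heat_L2[OF u] solves_heat_L2[OF v] u3 u4 v3 v4)
  have w3: "(\<lambda>t f. \<alpha> * u' t f + \<beta> * v' t f) \<in> ?D" if "?V \<noteq> {}"
    by (rule seminormed_functions.bochner_L2_comb[OF V0.dual_seminormed[OF that] u3 v3])
  have w5: "AE t in time_interval T. \<forall>f\<in>?V. \<forall>p. has_trace \<Omega> f p \<longrightarrow>
      (\<alpha> * u' t f + \<beta> * v' t f) + dirichlet_form \<Omega> (?w t) f
      = l2_inner ?H (g t) f - l2_inner (surface_on \<Gamma>2) (\<lambda>x. (\<alpha> * \<kappa> + \<beta> * \<mu>) * q t x) p"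
    using u5 v5 H1.bochner_L2_mem[OF solves_heat_H1[OF u]] H1.bochner_L2_mem[OF solves_heat_H1[OF v]]
  proof eventually_elim
    case (elim t)
    show ?case
    proof (intro ballI allI impI)
      \<comment> \<open>The same test function and the same trace \<open>p\<close> enter both
        equations, so they can be added as they stand.\<close>
      fix f p assume f: "f \<in> ?V" and p: "has_trace \<Omega> f p"
      let ?d = "dirichlet_form \<Omega>" and ?q = "l2_inner (surface_on \<Gamma>2) (q t) p"
      have "?d (?w t) f = \<alpha> * ?d (u t) f + \<beta> * ?d (v t) f"
        using elim(3,4) f by (intro dirichlet_form_comb_left[OF open_\<Omega> bounded_\<Omega>])
          (auto simp: H1_zero_on_def)
      moreover have eqs: "u' t f + ?d (u t) f = l2_inner ?H (g t) f - \<kappa> * ?q"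
          "v' t f + ?d (v t) f = l2_inner ?H (g t) f - \<mu> * ?q"
        using elim(1,2) f p by (auto simp: scale)
      have "\<alpha> * (u' t f + ?d (u t) f) + \<beta> * (v' t f + ?d (v t) f)
          = l2_inner ?H (g t) f - (\<alpha> * \<kappa> + \<beta> * \<mu>) * ?q"
        unfolding eqs by (simp add: \<beta> algebra_simps)
      ultimately show "(\<alpha> * u' t f + \<beta> * v' t f) + ?d (?w t) f
          = l2_inner ?H (g t) f - l2_inner (surface_on \<Gamma>2) (\<lambda>x. (\<alpha> * \<kappa> + \<beta> * \<mu>) * q t x) p"
        unfolding scale by (simp add: algebra_simps)
    qed
  qed
  \<comment> \<open>The dual norm needs a nonempty space; the zero function belongs to it, with the
    constant sequence 0 as witness for its trace.\<close>
  have "?V \<noteq> {}"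
  proof -
    have z: "(\<lambda>_. 0) \<in> H1 \<Omega>" using H1.scale_mem[OF vb, of 0] by simp
    have "h1_norm \<Omega> (\<lambda>_. 0) = 0" using H1.scale_le[OF vb, of 0] H1.nonneg[OF z] by simp
    moreover have "(\<lambda>_. 0 :: real) \<in> C_infinity" by (simp add: C_infinity_def C_upto_const)
    moreover have "(\<lambda>_. 0) \<in> L2 (surface_on (frontier \<Omega>))" by (simp add: L2_def)
    ultimately have "has_trace \<Omega> (\<lambda>_. 0) (\<lambda>_. 0)"
      using z unfolding has_trace_def
      by (intro conjI exI[of _ "\<lambda>_ _. 0"]) (auto simp: l2_norm_def l2_inner_def)
    then have "(\<lambda>_. 0) \<in> ?V" using z by (auto simp: H1_zero_on_def has_trace_on_def)
    then show ?thesis by blast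
  qed
  then show ?thesis
    unfolding solves_heat_def Let_def using w1 w2 w3 w4 w5 by blast
qed

end

section \<open>The cost as a quadratic polynomial\<close>

lemma bochner_norm_power2: "(bochner_norm T N u)\<^sup>2 = (LINT t|time_interval T. (N (u t))\<^sup>2)"
  by (simp add: bochner_norm_def)

text \<open>\<open>heat_state\<close> picks one of several solutions that agree up to
  \<open>bochner_eq\<close>; the norm in the cost must not depend on the pick.\<close>

lemma L2_L2_norm_cong:
  assumes u: "u \<in> L2_L2 T M" and v: "v \<in> L2_L2 T M" and eq: "bochner_eq T M u v"
  shows "L2_L2_norm T M u = L2_L2_norm T M v"
proof -
  have "(LINT t|time_interval T. (l2_norm M (u t))\<^sup>2) = (LINT t|time_interval T. (l2_norm M (v t))\<^sup>2)"
  proof (rule integral_cong_AE)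
    show "(\<lambda>t. (l2_norm M (u t))\<^sup>2) \<in> borel_measurable (time_interval T)"
      "(\<lambda>t. (l2_norm M (v t))\<^sup>2) \<in> borel_measurable (time_interval T)"
      using u v by (auto simp: bochner_L2_def)
    show "AE t in time_interval T. (l2_norm M (u t))\<^sup>2 = (l2_norm M (v t))\<^sup>2"
      using eq[unfolded bochner_eq_def] L2.bochner_L2_mem[OF u] L2.bochner_L2_mem[OF v]
    proof eventually_elim
      case (elim t)
      have "l2_inner M (u t) (u t) = l2_inner M (v t) (v t)"
        unfolding l2_inner_def
      proof (rule integral_cong_AE)
        show "AE x in M. u t x * u t x = v t x * v t x"
          using elim(1) by eventually_elim simp
      qed (use elim in \<open>auto simp: L2_def\<close>)
      then show ?case by (simp add: l2_norm_power2)
    qed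
  qed
  then show ?thesis by (simp add: bochner_norm_def)
qed

text \<open>Expanding the square is routine at almost every time. The difficulty is integrability of
  the mixed term: both of its factors move with \<open>t\<close>, so it is not a fixed functional of
  one of them.\<close>

lemma L2_L2_norm_affine:
  assumes A: "A \<in> L2_L2 T M" and B: "B \<in> L2_L2 T M"
  shows "(L2_L2_norm T M (\<lambda>t x. A t x + l * B t x))\<^sup>2 = (L2_L2_norm T M A)\<^sup>2
    + l * (2 * (LINT t|time_interval T. l2_inner M (A t) (B t))) + l\<^sup>2 * (L2_L2_norm T M B)\<^sup>2"
proof -
  let ?I = "time_interval T"
  let ?C = "\<lambda>c t x. 1 * A t x + c * B t x"
  have C: "?C c \<in> L2_L2 T M" for c by (rule L2.bochner_L2_comb[OF A B])
  have int: "integrable ?I (\<lambda>t. (l2_norm M (u t))\<^sup>2)" if "u \<in> L2_L2 T M" for u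
    using that by (simp add: bochner_L2_def)
  have expand: "AE t in ?I. (l2_norm M (?C c t))\<^sup>2
      = (l2_norm M (A t))\<^sup>2 + c * (2 * l2_inner M (A t) (B t)) + c\<^sup>2 * (l2_norm M (B t))\<^sup>2" for c
    using L2.bochner_L2_mem[OF A] L2.bochner_L2_mem[OF B]
  proof eventually_elim
    case (elim t)
    let ?c = "?C c t"
    have c: "?c \<in> L2 M" using elim by (rule L2_comb)
    have "l2_inner M ?c ?c = 1 * l2_inner M (A t) ?c + c * l2_inner M (B t) ?c"
      by (rule l2_inner_comb_left[OF elim c])
    also have "l2_inner M (A t) ?c = 1 * l2_inner M (A t) (A t) + c * l2_inner M (B t) (A t)"
      unfolding l2_inner_commute[of M "A t" ?c] by (rule l2_inner_comb_left[OF elim elim(1)])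
    also have "l2_inner M (B t) ?c = 1 * l2_inner M (A t) (B t) + c * l2_inner M (B t) (B t)"
      unfolding l2_inner_commute[of M "B t" ?c] by (rule l2_inner_comb_left[OF elim elim(2)])
    finally show ?case
      unfolding l2_norm_power2 by (simp add: l2_inner_commute[of M "B t" "A t"] algebra_simps power2_eq_square)
  qed
  \<comment> \<open>Polarisation: twice the inner product is almost everywhere a difference of
    integrable squared norms, the first of them being that of \<open>A + B\<close>.\<close>
  have int1: "integrable ?I (\<lambda>t. (l2_norm M (?C 1 t))\<^sup>2 - (l2_norm M (A t))\<^sup>2 - (l2_norm M (B t))\<^sup>2)"
    by (intro Bochner_Integration.integrable_diff int A B C)
  have ae: "AE t in ?I. (l2_norm M (?C 1 t))\<^sup>2 - (l2_norm M (A t))\<^sup>2 - (l2_norm M (B t))\<^sup>2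
      = 2 * l2_inner M (A t) (B t)"
    using expand[of 1] by eventually_elim simp
  have "(\<lambda>t. 2 * l2_inner M (A t) (B t)) \<in> borel_measurable ?I"
    by (rule borel_measurable_lebesgue_on_AE[OF _ borel_measurable_integrable[OF int1] ae]) simp
  from integrable_cong_AE_imp[OF int1 this] ae
  have AB: "integrable ?I (\<lambda>t. 2 * l2_inner M (A t) (B t))"
    by (simp add: eq_commute)
  have "(LINT t|?I. (l2_norm M (?C l t))\<^sup>2) = (LINT t|?I. (l2_norm M (A t))\<^sup>2
      + l * (2 * l2_inner M (A t) (B t)) + l\<^sup>2 * (l2_norm M (B t))\<^sup>2)"
    using int[OF A] int[OF B] int[OF C] AB expand
    by (intro integral_cong_AE) (auto intro!: borel_measurable_integrable)
  also have "\<dots> = (LINT t|?I. (l2_norm M (A t))\<^sup>2)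
      + l * (LINT t|?I. 2 * l2_inner M (A t) (B t)) + l\<^sup>2 * (LINT t|?I. (l2_norm M (B t))\<^sup>2)"
    using int[OF A] int[OF B] AB
    by (simp only: Bochner_Integration.integral_add Bochner_Integration.integrable_add
        integrable_mult_right integral_mult_right_zero)
  finally show ?thesis by (simp add: bochner_norm_power2)
qed

text \<open>A nonnegative function with integral 0 vanishes almost everywhere; this is used once in
  time and once more in space.\<close>

lemma L2_L2_norm_pos:
  assumes q: "q \<in> L2_L2 T M" and ne: "\<not> bochner_eq T M q (\<lambda>_ _. 0)"
  shows "(L2_L2_norm T M q)\<^sup>2 > 0"
proof (rule ccontr)
  assume "\<not> ?thesis"
  then have "(LINT t|time_interval T. (l2_norm M (q t))\<^sup>2) = 0"
    by (simp add: bochner_norm_power2)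
      (metis Bochner_Integration.integral_nonneg less_eq_real_def zero_le_power2)
  moreover have "integrable (time_interval T) (\<lambda>t. (l2_norm M (q t))\<^sup>2)"
    using q by (simp add: bochner_L2_def)
  ultimately have "AE t in time_interval T. (l2_norm M (q t))\<^sup>2 = 0"
    by (subst (asm) integral_nonneg_eq_0_iff_AE) auto
  then have "bochner_eq T M q (\<lambda>_ _. 0)"
    unfolding bochner_eq_def using L2.bochner_L2_mem[OF q]
  proof eventually_elim
    case (elim t)
    then have "(LINT x|M. q t x * q t x) = 0" "integrable M (\<lambda>x. q t x * q t x)"
      by (auto simp: l2_norm_power2 l2_inner_def L2_mult_integrable)
    then have "AE x in M. q t x * q t x = 0"
      by (subst (asm) integral_nonneg_eq_0_iff_AE) auto
    then show ?case by eventually_elim simp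
  qed
  with ne show False ..
qed

lemma quadratic_unique_minimiser:
  fixes f :: "real \<Rightarrow> real"
  assumes f: "\<And>l. f l = p + l * q + l\<^sup>2 * r" and r: "r > 0"
  shows "\<exists>!l. \<forall>m. f l \<le> f m"
proof -
  \<comment> \<open>Completing the square: the minimiser is \<open>- s\<close>, and
    \<open>f m\<close> exceeds its value by \<open>r * (m + s)\<^sup>2\<close>.\<close>
  define s where "s = q / (2 * r)"
  have q: "q = 2 * r * s" using r by (simp add: s_def)
  have sq: "f m = f (- s) + r * (m + s)\<^sup>2" for m
    by (simp add: f q algebra_simps power2_eq_square)
  show ?thesis
  proof (rule ex1I)
    show "\<forall>m. f (- s) \<le> f m"
    proof
      fix m
      have "0 \<le> r * (m + s)\<^sup>2" using r by simp
      then show "f (- s) \<le> f m" using sq[of m] by linarith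
    qed
  next
    fix l assume "\<forall>m. f l \<le> f m"
    then have "f l \<le> f (- s)" ..
    then have "r * (l + s)\<^sup>2 \<le> 0" using sq[of l] by linarith
    then show "l = - s" using r by (simp add: mult_le_0_iff)
  qed
qed

theorem theorem5p1:
  fixes \<Omega> \<Gamma>1 \<Gamma>2 :: "(real ^ 'n) set"
    and T M :: real
    and g z\<^sub>d q\<^sub>0 :: "real \<Rightarrow> real ^ 'n \<Rightarrow> real"
    and b v\<^sub>b :: "real ^ 'n \<Rightarrow> real"
  assumes domain: "regular_bounded_domain \<Omega>"
    and boundary: "frontier \<Omega> = \<Gamma>1 \<union> \<Gamma>2" "\<Gamma>1 \<inter> \<Gamma>2 = {}"
    and borel: "\<Gamma>1 \<in> sets borel" "\<Gamma>2 \<in> sets borel"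
    and positive: "emeasure surface_measure \<Gamma>1 > 0" "emeasure surface_measure \<Gamma>2 > 0"
    and T: "T > 0"
    and M: "M > 0"
    and g: "g \<in> L2_L2 T (lebesgue_on \<Omega>)"
    and zd: "z\<^sub>d \<in> L2_L2 T (lebesgue_on \<Omega>)"
    and b: "b \<in> H_half \<Gamma>1"
    and vb: "v\<^sub>b \<in> H1 \<Omega>" "has_trace_on \<Omega> \<Gamma>1 v\<^sub>b b"
    and well_posed: "heat_well_posed \<Omega> \<Gamma>1 \<Gamma>2 T g v\<^sub>b"
    and q0: "q\<^sub>0 \<in> L2_L2 T (surface_on \<Gamma>2)"
    and q0_nonzero: "\<not> bochner_eq T (surface_on \<Gamma>2) q\<^sub>0 (\<lambda>_ _. 0)"
  defines "H\<^sub>T \<equiv> \<lambda>l. cost \<Omega> \<Gamma>1 \<Gamma>2 T g v\<^sub>b z\<^sub>d M (\<lambda>t x. l * q\<^sub>0 t x)"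
  shows "\<exists>!l :: real. \<forall>m. H\<^sub>T l \<le> H\<^sub>T m"
proof -
  let ?H = "lebesgue_on \<Omega>" and ?Q = "surface_on \<Gamma>2"
  have \<Omega>: "open \<Omega>" "bounded \<Omega>" using domain by (auto simp: regular_bounded_domain_def)
  define U where "U l = heat_state \<Omega> \<Gamma>1 \<Gamma>2 T g v\<^sub>b (\<lambda>t x. l * q\<^sub>0 t x)" for l
  have control: "(\<lambda>t x. l * q\<^sub>0 t x) \<in> L2_L2 T ?Q" for l
    using L2.bochner_L2_comb[OF q0 q0, of l 0] by simp
  have wp: "\<exists>u. solves_heat \<Omega> \<Gamma>1 \<Gamma>2 T g v\<^sub>b (\<lambda>t x. l * q\<^sub>0 t x) u \<and>
      (\<forall>u'. solves_heat \<Omega> \<Gamma>1 \<Gamma>2 T g v\<^sub>b (\<lambda>t x. l * q\<^sub>0 t x) u' \<longrightarrow> bochner_eq T ?H u' u)" for l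
    using well_posed control unfolding heat_well_posed_def by blast
  have U: "solves_heat \<Omega> \<Gamma>1 \<Gamma>2 T g v\<^sub>b (\<lambda>t x. l * q\<^sub>0 t x) (U l)" for l
  proof -
    have "\<exists>u. solves_heat \<Omega> \<Gamma>1 \<Gamma>2 T g v\<^sub>b (\<lambda>t x. l * q\<^sub>0 t x) u" using wp[of l] by blast
    then show ?thesis unfolding U_def heat_state_def by (rule someI_ex)
  qed
  have UL2: "U l \<in> L2_L2 T ?H" for l
    by (rule solves_heat_L2[OF \<Omega> vb(1) U])
  \<comment> \<open>\<open>A\<close> is the deviation from the target at control 0, and
    \<open>B\<close> is the response of the state to one unit of \<open>q\<^sub>0\<close>. The
    combination of states minus \<open>z\<^sub>d\<close> is then \<open>A + l * B\<close>.\<close>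
  define A where "A = (\<lambda>t x. U 0 t x - z\<^sub>d t x)"
  define B where "B = (\<lambda>t x. U 1 t x - U 0 t x)"
  have A: "A \<in> L2_L2 T ?H" using L2.bochner_L2_comb[OF UL2 zd, of 1 0 "-1"] by (simp add: A_def)
  have B: "B \<in> L2_L2 T ?H" using L2.bochner_L2_comb[OF UL2 UL2, of 1 1 "-1" 0] by (simp add: B_def)
  have state: "L2_L2_norm T ?H (\<lambda>t x. U l t x - z\<^sub>d t x) = L2_L2_norm T ?H (\<lambda>t x. A t x + l * B t x)" for l
  proof (rule L2_L2_norm_cong)
    show "(\<lambda>t x. U l t x - z\<^sub>d t x) \<in> L2_L2 T ?H"
      using L2.bochner_L2_comb[OF UL2 zd, of 1 l "-1"] by simp
    show "(\<lambda>t x. A t x + l * B t x) \<in> L2_L2 T ?H"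
      using L2.bochner_L2_comb[OF A B, of 1 l] by simp
    have "solves_heat \<Omega> \<Gamma>1 \<Gamma>2 T g v\<^sub>b (\<lambda>t x. l * q\<^sub>0 t x) (\<lambda>t x. (1 - l) * U 0 t x + l * U 1 t x)"
      using solves_heat_affine[OF \<Omega> vb(1) U[of 0] U[of 1], of "1 - l" l] by simp
    \<comment> \<open>Well-posedness compares each solution with a reference solution
      \<open>u\<close>; the chosen state and the affine combination are identified through
      it.\<close>
    then obtain u where "bochner_eq T ?H (\<lambda>t x. (1 - l) * U 0 t x + l * U 1 t x) u" "bochner_eq T ?H (U l) u"
      using wp[of l] U[of l] by blast
    then show "bochner_eq T ?H (\<lambda>t x. U l t x - z\<^sub>d t x) (\<lambda>t x. A t x + l * B t x)"
      unfolding bochner_eq_def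
    proof eventually_elim
      case (elim t)
      then show ?case by eventually_elim (simp add: A_def B_def algebra_simps)
    qed
  qed
  have norm_control: "(L2_L2_norm T ?Q (\<lambda>t x. l * q\<^sub>0 t x))\<^sup>2 = l\<^sup>2 * (L2_L2_norm T ?Q q\<^sub>0)\<^sup>2" for l
    by (simp add: bochner_norm_power2 l2_norm_scale power_mult_distrib)
  show ?thesis
  proof (rule quadratic_unique_minimiser)
    \<comment> \<open>The factor 1/2 in the cost cancels the 2 of the mixed term, and the control
      contributes only to the coefficient of \<open>l\<^sup>2\<close>.\<close>
    show "H\<^sub>T l = 1/2 * (L2_L2_norm T ?H A)\<^sup>2 + l * (LINT t|time_interval T. l2_inner ?H (A t) (B t))
        + l\<^sup>2 * (1/2 * (L2_L2_norm T ?H B)\<^sup>2 + M/2 * (L2_L2_norm T ?Q q\<^sub>0)\<^sup>2)" for l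
      using state[of l] unfolding H\<^sub>T_def cost_def U_def
      by (simp add: norm_control L2_L2_norm_affine[OF A B] algebra_simps)
    show "1/2 * (L2_L2_norm T ?H B)\<^sup>2 + M/2 * (L2_L2_norm T ?Q q\<^sub>0)\<^sup>2 > 0"
      using L2_L2_norm_pos[OF q0 q0_nonzero] M by (intro add_nonneg_pos mult_pos_pos) auto
  qed
qed

end
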